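(* The semiflow $\Sigma:\Omega\to U$ is continuous, each set $\Omega_t=\{\phi\in U:(t,\phi)\in\Omega\}$, $t\ge0$, is open in $U$, and each solution operator $\Sigma_t:\Omega_t\to U\subset C$, $\Sigma_t(\phi)=\Sigma(t,\phi)$, with $t\ge0$ and $\Omega_t\neq\emptyset$, is $C^1_{\ast}$-smooth.
   Context: Let $n\in\mathbb{N}$ and let $C=C((-\infty,0],\mathbb{R}^n)$ be the Fréchet space of continuous maps $(-\infty,0]\to\mathbb{R}^n$ with the topology of locally uniform convergence (seminorms $|\phi|_j=\max_{-j\le t\le0}|\phi(t)|$, $j\in\mathbb{N}$). Let $U\subset C$ be open and let $f:U\to\mathbb{R}^n$ be $C^1_{\ast}$-smooth, where $\ast$ is either $MB$ or $F$ (the result holds in each case, with the same $\ast$ in hypothesis and conclusion). Smoothness: Let $V,W$ be topological vector spaces, $O\subset V$ open, $g:O\to W$ continuous, $Dg(u)v=\lim_{0\neq t\to0}\frac1t(g(u+tv)-g(u))$. The map $g$ is $C^1_{MB}$-smooth if all directional derivatives $Dg(u)v$, $u\in O,v\in V$, exist and $O\times V\ni(u,v)\mapsto Dg(u)v\in W$ is continuous. It is $C^1_F$-smooth if all directional derivatives exist, each $Dg(u):V\to W$ is linear and continuous, and $O\ni u\mapsto Dg(u)\in L_c(V,W)$ is continuous with respect to the topology of uniform convergence on bounded sets on the space $L_c(V,W)$ of continuous linear maps. Solutions: For an interval $I\subset\mathbb{R}$ a solution of $x'(t)=f(x_t)$ on $I$ is a continuous map $x:(-\infty,0]+I\to\mathbb{R}^n$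 such that for all $t\in I$ the segment $x_t:(-\infty,0]\ni s\mapsto x(t+s)\in\mathbb{R}^n$ belongs to $U$, and $x|_I$ is differentiable and satisfies $x'(t)=f(x_t)$ for all $t\in I$ (one-sided derivatives at endpoints belonging to $I$). For $\phi\in U$ set $t_{\phi}=\sup\{t>0:\text{there is a solution of }x'(t)=f(x_t)\text{ on }[0,t]\text{ with }x_0=\phi\}\le\infty$; one has $t_\phi>0$, and $x^{\phi}:(-\infty,t_\phi)\to\mathbb{R}^n$ denotes the maximal solution on $[0,t_{\phi})$ with $x^{\phi}_0=\phi$ (every solution on an interval $I$ of positive length with $\min I=0$ and $x_0=\phi$ is a restriction of $x^\phi$). Set $\Omega=\{(t,\phi)\in[0,\infty)\times U:t<t_{\phi}\}$ and define $\Sigma:\Omega\to U$ by $\Sigma(t,\phi)=x^{\phi}_t$. *)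

theory Defs
  imports "HOL-Analysis.Analysis"
begin

section \<open>Topological vector spaces and two notions of continuous differentiability\<close>

class real_tvs = real_vector + topological_ab_group_add +
  assumes tendsto_scaleR_nhds:
    "((\<lambda>p. fst p *\<^sub>R snd p) \<longlongrightarrow> c *\<^sub>R x) (nhds c \<times>\<^sub>F nhds x)"

instance real_normed_vector \<subseteq> real_tvs
  by standard (intro tendsto_scaleR filterlim_fst filterlim_snd)

text \<open>The limits are taken over nonzero real \<open>t\<close>. Values of \<open>g\<close> outside of an open set
  containing \<open>u\<close> are irrelevant, since \<open>u + t *\<^sub>R v\<close> is eventually in that set. The codomain is
  Hausdorff, so that the limit is unique.\<close>

definition dir_differentiable ::
    "('a::real_tvs \<Rightarrow> 'b::{real_tvs,t2_space}) \<Rightarrow> 'a \<Rightarrow> 'a \<Rightarrow> bool" where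
  "dir_differentiable g u v \<longleftrightarrow> (\<exists>w. ((\<lambda>t::real. (1 / t) *\<^sub>R (g (u + t *\<^sub>R v) - g u)) \<longlongrightarrow> w) (at 0))"

definition dir_deriv ::
    "('a::real_tvs \<Rightarrow> 'b::{real_tvs,t2_space}) \<Rightarrow> 'a \<Rightarrow> 'a \<Rightarrow> 'b" where
  "dir_deriv g u v = Lim (at (0::real)) (\<lambda>t. (1 / t) *\<^sub>R (g (u + t *\<^sub>R v) - g u))"

definition C1_MB :: "'a set \<Rightarrow> ('a::real_tvs \<Rightarrow> 'b::{real_tvs,t2_space}) \<Rightarrow> bool" where
  "C1_MB O' g \<longleftrightarrow> open O' \<and> continuous_on O' g \<and>
     (\<forall>u\<in>O'. \<forall>v. dir_differentiable g u v) \<and>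
     continuous_on (O' \<times> UNIV) (\<lambda>(u, v). dir_deriv g u v)"

definition tvs_bounded :: "'a::real_tvs set \<Rightarrow> bool" where
  "tvs_bounded B \<longleftrightarrow> (\<forall>N. open N \<and> 0 \<in> N \<longrightarrow> (\<exists>r>0. \<forall>s\<ge>r. B \<subseteq> (*\<^sub>R) s ` N))"

definition Lc :: "('a::real_tvs \<Rightarrow> 'b::real_tvs) set" where
  "Lc = {A. linear A \<and> continuous_on UNIV A}"

text \<open>The topology of uniform convergence on bounded sets: the sets
  \<open>{A' \<in> Lc. \<forall>v\<in>B. A' v - A v \<in> N}\<close>, with \<open>B\<close> bounded and \<open>N\<close> an open neighbourhood of \<open>0\<close>,
  form a base of neighbourhoods of \<open>A\<close>.\<close>

definition Lc_topology :: "('a::real_tvs \<Rightarrow> 'b::real_tvs) topology" where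
  "Lc_topology = topology (\<lambda>\<U>. \<U> \<subseteq> Lc \<and>
     (\<forall>A\<in>\<U>. \<exists>B N. tvs_bounded B \<and> open N \<and> 0 \<in> N \<and> {A'\<in>Lc. \<forall>v\<in>B. A' v - A v \<in> N} \<subseteq> \<U>))"

lemma tvs_bounded_empty: "tvs_bounded {}"
  unfolding tvs_bounded_def by (auto intro: exI[of _ 1])

lemma tvs_bounded_Un:
  assumes "tvs_bounded B" "tvs_bounded B'"
  shows "tvs_bounded (B \<union> B')"
  unfolding tvs_bounded_def
proof (intro allI impI)
  fix N :: "'a set" assume N: "open N \<and> 0 \<in> N"
  obtain r where r: "r > 0" "\<forall>s\<ge>r. B \<subseteq> (*\<^sub>R) s ` N"
    using assms(1) N unfolding tvs_bounded_def by blast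
  obtain r' where r': "r' > 0" "\<forall>s\<ge>r'. B' \<subseteq> (*\<^sub>R) s ` N"
    using assms(2) N unfolding tvs_bounded_def by blast
  show "\<exists>r>0. \<forall>s\<ge>r. B \<union> B' \<subseteq> (*\<^sub>R) s ` N"
    using r r' by (intro exI[of _ "max r r'"]) auto
qed

lemma openin_Lc_topology:
  "openin Lc_topology \<U> \<longleftrightarrow> \<U> \<subseteq> Lc \<and>
     (\<forall>A\<in>\<U>. \<exists>B N. tvs_bounded B \<and> open N \<and> 0 \<in> N \<and> {A'\<in>Lc. \<forall>v\<in>B. A' v - A v \<in> N} \<subseteq> \<U>)"
proof -
  let ?P = "\<lambda>\<U> (A::'a \<Rightarrow> 'b) B N. tvs_bounded B \<and> open N \<and> 0 \<in> N \<and>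
    {A'\<in>Lc. \<forall>v\<in>B. A' v - A v \<in> N} \<subseteq> \<U>"
  have "istopology (\<lambda>\<U>. \<U> \<subseteq> Lc \<and> (\<forall>A\<in>\<U>. \<exists>B N. ?P \<U> A B N))"
    unfolding istopology_def
  proof (intro conjI allI impI)
    fix S T :: "('a \<Rightarrow> 'b) set"
    assume S: "S \<subseteq> Lc \<and> (\<forall>A\<in>S. \<exists>B N. ?P S A B N)" and T: "T \<subseteq> Lc \<and> (\<forall>A\<in>T. \<exists>B N. ?P T A B N)"
    show "S \<inter> T \<subseteq> Lc" using S by blast
    show "\<forall>A\<in>S \<inter> T. \<exists>B N. ?P (S \<inter> T) A B N"
    proof
      fix A assume "A \<in> S \<inter> T"
      then have "\<exists>B N. ?P S A B N" "\<exists>B N. ?P T A B N" using S T by auto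
      then obtain B N B' N' where "?P S A B N" "?P T A B' N'" by (elim exE)
      then have "?P (S \<inter> T) A (B \<union> B') (N \<inter> N')"
        by (auto intro: tvs_bounded_Un)
      then show "\<exists>B N. ?P (S \<inter> T) A B N" by blast
    qed
  next
    fix K :: "('a \<Rightarrow> 'b) set set"
    assume K: "\<forall>S\<in>K. S \<subseteq> Lc \<and> (\<forall>A\<in>S. \<exists>B N. ?P S A B N)"
    show "\<Union>K \<subseteq> Lc" using K by blast
    show "\<forall>A\<in>\<Union>K. \<exists>B N. ?P (\<Union>K) A B N"
    proof
      fix A assume "A \<in> \<Union>K"
      then obtain S where "S \<in> K" "A \<in> S" by blast
      with K have "\<exists>B N. ?P S A B N" by auto
      then obtain B N where "?P S A B N" by (elim exE)
      then have "?P (\<Union>K) A B N" using \<open>S \<in> K\<close> by blast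
      then show "\<exists>B N. ?P (\<Union>K) A B N" by blast
    qed
  qed
  then show ?thesis
    unfolding Lc_topology_def by (simp add: topology_inverse')
qed

lemma topspace_Lc_topology: "topspace Lc_topology = (Lc :: ('a::real_tvs \<Rightarrow> 'b::real_tvs) set)"
proof
  show "topspace Lc_topology \<subseteq> (Lc :: ('a \<Rightarrow> 'b) set)"
    using openin_Lc_topology openin_topspace by blast
  have "openin Lc_topology (Lc :: ('a \<Rightarrow> 'b) set)"
    unfolding openin_Lc_topology using tvs_bounded_empty open_UNIV by blast
  then show "(Lc :: ('a \<Rightarrow> 'b) set) \<subseteq> topspace Lc_topology"
    by (rule openin_subset)
qed

definition C1_F :: "'a set \<Rightarrow> ('a::real_tvs \<Rightarrow> 'b::{real_tvs,t2_space}) \<Rightarrow> bool" where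
  "C1_F O' g \<longleftrightarrow> open O' \<and> continuous_on O' g \<and>
     (\<forall>u\<in>O'. \<forall>v. dir_differentiable g u v) \<and>
     (\<forall>u\<in>O'. dir_deriv g u \<in> Lc) \<and>
     continuous_map (top_of_set O') Lc_topology (\<lambda>u. dir_deriv g u)"

datatype smoothness = MB | F

fun C1_smooth :: "smoothness \<Rightarrow> 'a set \<Rightarrow> ('a::real_tvs \<Rightarrow> 'b::{real_tvs,t2_space}) \<Rightarrow> bool" where
  "C1_smooth MB O' g \<longleftrightarrow> C1_MB O' g"
| "C1_smooth F O' g \<longleftrightarrow> C1_F O' g"

section \<open>The Frechet space of continuous maps on the nonpositive half-line\<close>

text \<open>A continuous map on \<open>{..0}\<close> is represented by its extension to all reals that is constant on
  \<open>{0..}\<close>. The values at positive arguments carry no information.\<close>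

typedef (overloaded) 'b history =
  "{\<phi> :: real \<Rightarrow> 'b::real_normed_vector. continuous_on {..0} \<phi> \<and> (\<forall>t>0. \<phi> t = \<phi> 0)}"
  morphisms happly Abs_history
  by (rule exI[of _ "\<lambda>_. 0"]) auto

setup_lifting type_definition_history

lemma history_eqI: "(\<And>t. t \<le> 0 \<Longrightarrow> happly \<phi> t = happly \<psi> t) \<Longrightarrow> \<phi> = \<psi>"
  by transfer (metis linorder_not_le order_refl ext)

lemma continuous_on_happly: "continuous_on {..0} (happly \<phi>)"
  by transfer simp

instantiation history :: (real_normed_vector) real_vector
begin

lift_definition zero_history :: "'a history" is "\<lambda>_. 0" by auto
lift_definition plus_history :: "'a history \<Rightarrow> 'a history \<Rightarrow> 'a history"
  is "\<lambda>\<phi> \<psi> t. \<phi> t + \<psi> t" by (auto intro: continuous_intros)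
lift_definition minus_history :: "'a history \<Rightarrow> 'a history \<Rightarrow> 'a history"
  is "\<lambda>\<phi> \<psi> t. \<phi> t - \<psi> t" by (auto intro: continuous_intros)
lift_definition uminus_history :: "'a history \<Rightarrow> 'a history"
  is "\<lambda>\<phi> t. - \<phi> t" by (auto intro: continuous_intros)
lift_definition scaleR_history :: "real \<Rightarrow> 'a history \<Rightarrow> 'a history"
  is "\<lambda>c \<phi> t. c *\<^sub>R \<phi> t" by (auto intro: continuous_intros)

instance
  by standard (transfer; simp add: fun_eq_iff algebra_simps)+

end

lemma happly_simps:
  "happly 0 t = 0" "happly (\<phi> + \<psi>) t = happly \<phi> t + happly \<psi> t"
  "happly (\<phi> - \<psi>) t = happly \<phi> t - happly \<psi> t" "happly (- \<phi>) t = - happly \<phi> t"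
  "happly (c *\<^sub>R \<phi>) t = c *\<^sub>R happly \<phi> t"
  by (transfer; simp)+

definition hsemi :: "nat \<Rightarrow> 'b::real_normed_vector history \<Rightarrow> real" where
  "hsemi j \<phi> = (SUP t\<in>{- real j..0}. norm (happly \<phi> t))"

lemma bdd_above_history: "bdd_above ((\<lambda>t. norm (happly \<phi> t)) ` {- real j..0})"
proof -
  have "continuous_on {- real j..0} (\<lambda>t. norm (happly \<phi> t))"
    by (intro continuous_intros continuous_on_subset[OF continuous_on_happly]) auto
  then have "compact ((\<lambda>t. norm (happly \<phi> t)) ` {- real j..0})"
    using compact_continuous_image compact_Icc by blast
  then show ?thesis
    by (intro bounded_imp_bdd_above compact_imp_bounded)
qed

lemma norm_le_hsemi: "- real j \<le> t \<Longrightarrow> t \<le> 0 \<Longrightarrow> norm (happly \<phi> t) \<le> hsemi j \<phi>"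
  unfolding hsemi_def by (intro cSUP_upper bdd_above_history) auto

lemma hsemi_le: "(\<And>t. - real j \<le> t \<Longrightarrow> t \<le> 0 \<Longrightarrow> norm (happly \<phi> t) \<le> c) \<Longrightarrow> hsemi j \<phi> \<le> c"
  unfolding hsemi_def by (intro cSUP_least) auto

lemma hsemi_nonneg: "0 \<le> hsemi j \<phi>"
  using norm_le_hsemi[of j 0 \<phi>] norm_ge_zero[of "happly \<phi> 0"] by linarith

lemma hsemi_zero: "hsemi j 0 = 0"
  by (intro antisym hsemi_le hsemi_nonneg) (simp add: happly_simps)

lemma hsemi_mono: "i \<le> j \<Longrightarrow> hsemi i \<phi> \<le> hsemi j \<phi>"
  by (intro hsemi_le norm_le_hsemi) auto

lemma hsemi_triangle: "hsemi j (\<phi> + \<psi>) \<le> hsemi j \<phi> + hsemi j \<psi>"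
proof (rule hsemi_le)
  fix t assume "- real j \<le> t" "t \<le> 0"
  then show "norm (happly (\<phi> + \<psi>) t) \<le> hsemi j \<phi> + hsemi j \<psi>"
    unfolding happly_simps by (intro norm_triangle_mono norm_le_hsemi)
qed

lemma hsemi_scaleR_le: "hsemi j (c *\<^sub>R \<phi>) \<le> \<bar>c\<bar> * hsemi j \<phi>"
  by (rule hsemi_le) (auto simp: happly_simps intro!: mult_left_mono norm_le_hsemi)

lemma hsemi_uminus: "hsemi j (- \<phi>) = hsemi j \<phi>"
  unfolding hsemi_def happly_simps by simp

instantiation history :: (real_normed_vector) topological_space
begin

text \<open>The seminorms increase with their index, so a single one suffices for a basic
  neighbourhood.\<close>

definition open_history :: "'a history set \<Rightarrow> bool" where
  "open_history U \<longleftrightarrow> (\<forall>\<phi>\<in>U. \<exists>j. \<exists>e>0. \<forall>\<psi>. hsemi j (\<psi> - \<phi>) < e \<longrightarrow> \<psi> \<in> U)"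

instance
proof
  show "open (UNIV :: 'a history set)"
    unfolding open_history_def by (auto intro: exI[of _ 1])
next
  fix S T :: "'a history set"
  assume S: "open S" and T: "open T"
  show "open (S \<inter> T)" unfolding open_history_def
  proof
    fix \<phi> assume \<phi>: "\<phi> \<in> S \<inter> T"
    obtain i d where i: "d > 0" "\<And>\<psi>. hsemi i (\<psi> - \<phi>) < d \<Longrightarrow> \<psi> \<in> S"
      using S \<phi> unfolding open_history_def by blast
    obtain j e where j: "e > 0" "\<And>\<psi>. hsemi j (\<psi> - \<phi>) < e \<Longrightarrow> \<psi> \<in> T"
      using T \<phi> unfolding open_history_def by blast
    have "\<psi> \<in> S \<inter> T" if "hsemi (max i j) (\<psi> - \<phi>) < min d e" for \<psi>
      using i(2)[of \<psi>] j(2)[of \<psi>] that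
        hsemi_mono[of i "max i j" "\<psi> - \<phi>"] hsemi_mono[of j "max i j" "\<psi> - \<phi>"] by auto
    then show "\<exists>j. \<exists>e>0. \<forall>\<psi>. hsemi j (\<psi> - \<phi>) < e \<longrightarrow> \<psi> \<in> S \<inter> T"
      using i(1) j(1) by (intro exI[of _ "max i j"] exI[of _ "min d e"]) auto
  qed
next
  fix K :: "'a history set set"
  assume "\<forall>S\<in>K. open S"
  then show "open (\<Union>K)" unfolding open_history_def by (meson Union_iff)
qed

end

lemma open_hsemi_ball: "open {\<psi>. hsemi j (\<psi> - \<phi>) < e}"
  unfolding open_history_def
proof
  fix \<eta> assume \<eta>: "\<eta> \<in> {\<psi>. hsemi j (\<psi> - \<phi>) < e}"
  have "hsemi j (\<psi> - \<phi>) < e" if "hsemi j (\<psi> - \<eta>) < e - hsemi j (\<eta> - \<phi>)" for \<psi>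
    using hsemi_triangle[of j "\<psi> - \<eta>" "\<eta> - \<phi>"] that by simp
  then show "\<exists>i. \<exists>d>0. \<forall>\<psi>. hsemi i (\<psi> - \<eta>) < d \<longrightarrow> \<psi> \<in> {\<psi>. hsemi j (\<psi> - \<phi>) < e}"
    using \<eta> by (intro exI[of _ j] exI[of _ "e - hsemi j (\<eta> - \<phi>)"]) auto
qed

lemma tendsto_0_le_hsemi:
  assumes "(g \<longlongrightarrow> 0) G" "\<And>x. hsemi j (h x) \<le> g x"
  shows "((\<lambda>x. hsemi j (h x)) \<longlongrightarrow> 0) G"
  by (rule tendsto_sandwich[OF always_eventually always_eventually tendsto_const assms(1)])
    (auto simp: hsemi_nonneg assms(2))

lemma tendsto_history_iff:
  "(f \<longlongrightarrow> \<phi>) G \<longleftrightarrow> (\<forall>j. ((\<lambda>x. hsemi j (f x - \<phi>)) \<longlongrightarrow> 0) G)"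
proof
  assume f: "(f \<longlongrightarrow> \<phi>) G"
  show "\<forall>j. ((\<lambda>x. hsemi j (f x - \<phi>)) \<longlongrightarrow> 0) G"
  proof (intro allI tendstoI)
    fix j and e :: real assume "e > 0"
    then show "\<forall>\<^sub>F x in G. dist (hsemi j (f x - \<phi>)) 0 < e"
      using topological_tendstoD[OF f open_hsemi_ball[of j \<phi> e]]
      by (simp add: hsemi_zero hsemi_nonneg)
  qed
next
  assume f: "\<forall>j. ((\<lambda>x. hsemi j (f x - \<phi>)) \<longlongrightarrow> 0) G"
  show "(f \<longlongrightarrow> \<phi>) G"
  proof (rule topological_tendstoI)
    fix S assume "open S" "\<phi> \<in> S"
    then obtain j e where *: "e > 0" "\<And>\<psi>. hsemi j (\<psi> - \<phi>) < e \<Longrightarrow> \<psi> \<in> S"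
      unfolding open_history_def by blast
    have "\<forall>\<^sub>F x in G. hsemi j (f x - \<phi>) < e"
      using order_tendstoD(2)[OF spec[OF f, of j]] *(1) by simp
    then show "\<forall>\<^sub>F x in G. f x \<in> S"
      by eventually_elim (rule *(2))
  qed
qed

instance history :: (real_normed_vector) t2_space
proof
  fix \<phi> \<psi> :: "'a history"
  assume "\<phi> \<noteq> \<psi>"
  then obtain t where t: "t \<le> 0" "happly \<phi> t \<noteq> happly \<psi> t"
    using history_eqI by blast
  obtain j :: nat where j: "- t \<le> real j" using real_arch_simple by blast
  define e where "e = norm (happly (\<phi> - \<psi>) t) / 2"
  have e: "e > 0" using t unfolding e_def by (simp add: happly_simps)
  have "2 * e \<le> hsemi j (\<phi> - \<psi>)"
    unfolding e_def using norm_le_hsemi[of j t "\<phi> - \<psi>"] t j by simp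
  moreover have "hsemi j (\<phi> - \<psi>) \<le> hsemi j (\<eta> - \<phi>) + hsemi j (\<eta> - \<psi>)" for \<eta>
    using hsemi_triangle[of j "\<phi> - \<eta>" "\<eta> - \<psi>"] hsemi_uminus[of j "\<eta> - \<phi>"] by simp
  ultimately have "{\<eta>. hsemi j (\<eta> - \<phi>) < e} \<inter> {\<eta>. hsemi j (\<eta> - \<psi>) < e} = {}"
    by (smt (verit) disjoint_iff mem_Collect_eq)
  moreover have "\<phi> \<in> {\<eta>. hsemi j (\<eta> - \<phi>) < e}" "\<psi> \<in> {\<eta>. hsemi j (\<eta> - \<psi>) < e}"
    using e by (simp_all add: hsemi_zero)
  ultimately show "\<exists>U V. open U \<and> open V \<and> \<phi> \<in> U \<and> \<psi> \<in> V \<and> U \<inter> V = {}"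
    using open_hsemi_ball by metis
qed

instance history :: (real_normed_vector) topological_ab_group_add
proof
  fix \<phi> \<psi> :: "'a history"
  show "((\<lambda>x. fst x + snd x) \<longlongrightarrow> \<phi> + \<psi>) (nhds \<phi> \<times>\<^sub>F nhds \<psi>)"
    unfolding tendsto_history_iff
  proof
    fix j
    have "(fst \<longlongrightarrow> \<phi>) (nhds \<phi> \<times>\<^sub>F nhds \<psi>)" "(snd \<longlongrightarrow> \<psi>) (nhds \<phi> \<times>\<^sub>F nhds \<psi>)"
      by (simp_all add: filterlim_fst filterlim_snd)
    then have "((\<lambda>x. hsemi j (fst x - \<phi>) + hsemi j (snd x - \<psi>)) \<longlongrightarrow> 0 + 0) (nhds \<phi> \<times>\<^sub>F nhds \<psi>)"
      unfolding tendsto_history_iff by (intro tendsto_add) auto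
    moreover have "hsemi j (fst x + snd x - (\<phi> + \<psi>)) \<le> hsemi j (fst x - \<phi>) + hsemi j (snd x - \<psi>)" for x
      using hsemi_triangle[of j "fst x - \<phi>" "snd x - \<psi>"] by (simp add: algebra_simps)
    ultimately show "((\<lambda>x. hsemi j (fst x + snd x - (\<phi> + \<psi>))) \<longlongrightarrow> 0) (nhds \<phi> \<times>\<^sub>F nhds \<psi>)"
      by (intro tendsto_0_le_hsemi) auto
  qed
next
  fix \<phi> :: "'a history"
  have *: "hsemi j (- x - - \<phi>) = hsemi j (x - \<phi>)" for j and x
    using hsemi_uminus[of j "x - \<phi>"] by simp
  have "(id \<longlongrightarrow> \<phi>) (nhds \<phi>)" by (simp add: id_def filterlim_ident)
  then show "(uminus \<longlongrightarrow> - \<phi>) (nhds \<phi>)"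
    unfolding tendsto_history_iff id_def
    unfolding * .
qed

instance history :: (real_normed_vector) real_tvs
proof
  fix c :: real and \<phi> :: "'a history"
  let ?G = "nhds c \<times>\<^sub>F nhds \<phi>"
  let ?a = "fst :: real \<times> 'a history \<Rightarrow> real" and ?b = "snd :: real \<times> 'a history \<Rightarrow> 'a history"
  have a: "(?a \<longlongrightarrow> c) ?G" and b: "(?b \<longlongrightarrow> \<phi>) ?G"
    by (simp_all add: filterlim_fst filterlim_snd)
  show "((\<lambda>p. ?a p *\<^sub>R ?b p) \<longlongrightarrow> c *\<^sub>R \<phi>) ?G"
    unfolding tendsto_history_iff
  proof
    fix j
    have "((\<lambda>p. \<bar>?a p\<bar> * hsemi j (?b p - \<phi>) + \<bar>?a p - c\<bar> * hsemi j \<phi>) \<longlongrightarrow> \<bar>c\<bar> * 0 + \<bar>c - c\<bar> * hsemi j \<phi>) ?G"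
      using b unfolding tendsto_history_iff
      by (intro tendsto_add tendsto_mult tendsto_rabs tendsto_diff tendsto_const a) auto
    moreover have "hsemi j (?a p *\<^sub>R ?b p - c *\<^sub>R \<phi>) \<le> \<bar>?a p\<bar> * hsemi j (?b p - \<phi>) + \<bar>?a p - c\<bar> * hsemi j \<phi>" for p
      using hsemi_triangle[of j "?a p *\<^sub>R (?b p - \<phi>)" "(?a p - c) *\<^sub>R \<phi>"]
        hsemi_scaleR_le[of j "?a p" "?b p - \<phi>"] hsemi_scaleR_le[of j "?a p - c" "\<phi>"]
      by (simp add: algebra_simps)
    ultimately show "((\<lambda>p. hsemi j (?a p *\<^sub>R ?b p - c *\<^sub>R \<phi>)) \<longlongrightarrow> 0) ?G"
      by (intro tendsto_0_le_hsemi) auto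
  qed
qed

section \<open>Delay differential equations and their solutions\<close>

text \<open>If \<open>x\<close> is continuous on \<open>{..t}\<close>, then \<open>segment x t\<close> is the element \<open>s \<mapsto> x (t + s)\<close>, \<open>s \<le> 0\<close>, of
  the history space (with the constant extension for \<open>s > 0\<close>).\<close>

definition segment :: "(real \<Rightarrow> 'b::real_normed_vector) \<Rightarrow> real \<Rightarrow> 'b history" where
  "segment x t = Abs_history (\<lambda>s. x (t + min s 0))"

lemma happly_segment:
  assumes "continuous_on {..t} x" "s \<le> 0"
  shows "happly (segment x t) s = x (t + s)"
proof -
  have "continuous_on {..0} (\<lambda>s. x (t + min s 0))"
    by (rule continuous_on_compose2[OF assms(1)]) (intro continuous_intros, auto)
  then show ?thesis
    unfolding segment_def using assms(2) by (subst Abs_history_inverse) auto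
qed

text \<open>Here \<open>{..0} + I\<close> is the elementwise sum of sets. The derivative within \<open>I\<close> is one-sided at
  endpoints belonging to \<open>I\<close>.\<close>

definition is_solution ::
    "('b::real_normed_vector history \<Rightarrow> 'b) \<Rightarrow> 'b history set \<Rightarrow> real set \<Rightarrow> (real \<Rightarrow> 'b) \<Rightarrow> bool" where
  "is_solution f U I x \<longleftrightarrow> is_interval I \<and> continuous_on ({..0} + I) x \<and>
     (\<forall>t\<in>I. segment x t \<in> U \<and> (x has_vector_derivative f (segment x t)) (at t within I))"

definition escape_time ::
    "('b::real_normed_vector history \<Rightarrow> 'b) \<Rightarrow> 'b history set \<Rightarrow> 'b history \<Rightarrow> ereal" where
  "escape_time f U \<phi> =
     Sup (ereal ` {t. 0 < t \<and> (\<exists>x. is_solution f U {0..t} x \<and> segment x 0 = \<phi>)})"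

text \<open>Maximal solutions are unique on \<open>{t. ereal t < escape_time f U \<phi>}\<close> for the right-hand sides
  considered here; only their values there matter below.\<close>

definition maximal_solution ::
    "('b::real_normed_vector history \<Rightarrow> 'b) \<Rightarrow> 'b history set \<Rightarrow> 'b history \<Rightarrow> real \<Rightarrow> 'b" where
  "maximal_solution f U \<phi> =
     (SOME x. is_solution f U {t. 0 \<le> t \<and> ereal t < escape_time f U \<phi>} x \<and> segment x 0 = \<phi>)"

definition semiflow_domain ::
    "('b::real_normed_vector history \<Rightarrow> 'b) \<Rightarrow> 'b history set \<Rightarrow> (real \<times> 'b history) set" where
  "semiflow_domain f U = {(t, \<phi>). 0 \<le> t \<and> \<phi> \<in> U \<and> ereal t < escape_time f U \<phi>}"

definition semiflow ::
    "('b::real_normed_vector history \<Rightarrow> 'b) \<Rightarrow> 'b history set \<Rightarrow> real \<times> 'b history \<Rightarrow> 'b history" where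
  "semiflow f U = (\<lambda>(t, \<phi>). segment (maximal_solution f U \<phi>) t)"

definition solution_operator_domain ::
    "('b::real_normed_vector history \<Rightarrow> 'b) \<Rightarrow> 'b history set \<Rightarrow> real \<Rightarrow> 'b history set" where
  "solution_operator_domain f U t = {\<phi> \<in> U. (t, \<phi>) \<in> semiflow_domain f U}"

definition solution_operator ::
    "('b::real_normed_vector history \<Rightarrow> 'b) \<Rightarrow> 'b history set \<Rightarrow> real \<Rightarrow> 'b history \<Rightarrow> 'b history" where
  "solution_operator f U t = (\<lambda>\<phi>. semiflow f U (t, \<phi>))"

end

theory Submission
  imports Defs
begin

text \<open>Joint continuity of the derivative bounds \<open>dir_deriv f \<psi> v\<close>, for \<open>\<psi>\<close> near a given point, by a
  multiple of one seminorm of \<open>v\<close>. Hence \<open>f\<close> locally has bounded delay and is Lipschitz with respect to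
  that seminorm, and by compactness the same index works along a whole solution on \<open>[0, T]\<close>. A Gronwall
  estimate in this tube gives uniqueness, solutions on \<open>[0, T]\<close> for all nearby initial data, and their
  Lipschitz dependence on the data, hence continuity of the semiflow and open domains. The directional
  derivative of the time-\<open>t\<close> map is the segment at \<open>t\<close> of the solution \<open>w\<close> of the linearized equation:
  the deviation of the difference quotients from \<open>w\<close> satisfies the linearized equation up to an error
  that vanishes uniformly on \<open>[0, T]\<close>. The same estimate shows that \<open>w\<close> depends continuously on the base
  point and on its initial value, uniformly for initial values in bounded sets if \<open>f\<close> is \<open>C1_F\<close>. As
  \<open>C1_F\<close> implies \<open>C1_MB\<close> on the first countable history space, both cases share this argument.\<close>

section \<open>Histories and segments\<close>

text \<open>The history space has no norm, hence no operator norm to bound derivatives by, and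
  \<open>C1_MB\<close> controls \<open>Df \<psi> v\<close> only for \<open>v\<close> near a fixed
  vector, thus uniformly along compact curves. This decides how the equation is linearized. With
  \<open>x\<close> the given solution, \<open>y\<close> the perturbed one for the step
  \<open>h\<close>, and \<open>w\<close> the solution of the linearized equation,
  \<open>f (segment y s) - f (segment x s)\<close> is not expanded along
  \<open>segment y s - segment x s\<close>, which varies with \<open>h\<close>. It is split at the
  intermediate point \<open>segment x s + h *\<^sub>R segment w s\<close>: the first part is
  absorbed by the Lipschitz bound of the tube, and the second is linearized along the fixed compact
  curve of segments of \<open>w\<close>. The single index \<open>n\<close> of a tube makes the
  Gronwall argument scalar, since it sees only the times from \<open>- n\<close> to
  \<open>T\<close>. Every other seminorm is then recovered from the initial histories. Existence is
  a fixed point problem for bounded continuous functions of time, which form a Banach space.\<close>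

definition hball :: "nat \<Rightarrow> 'b::real_normed_vector history \<Rightarrow> 'b history set" where
  "hball n \<phi> = {\<psi>. hsemi n (\<psi> - \<phi>) < 1 / real (Suc n)}"

lemma hsemi_diff_triangle: "hsemi n (\<phi> - \<zeta>) \<le> hsemi n (\<phi> - \<psi>) + hsemi n (\<psi> - \<zeta>)"
  using hsemi_triangle[of n "\<phi> - \<psi>" "\<psi> - \<zeta>"] by simp

lemma hsemi_scaleR: "hsemi n (c *\<^sub>R \<phi>) = \<bar>c\<bar> * hsemi n \<phi>"
proof (cases "c = 0")
  case False
  have "hsemi n \<phi> \<le> \<bar>inverse c\<bar> * hsemi n (c *\<^sub>R \<phi>)"
    using hsemi_scaleR_le[of n "inverse c" "c *\<^sub>R \<phi>"] False by simp
  then have "\<bar>c\<bar> * hsemi n \<phi> \<le> hsemi n (c *\<^sub>R \<phi>)"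
    using False by (simp add: abs_inverse field_simps)
  then show ?thesis using hsemi_scaleR_le[of n c \<phi>] by simp
qed (simp add: hsemi_zero)

lemma center_in_hball: "\<phi> \<in> hball n \<phi>"
  by (simp add: hball_def hsemi_zero)

lemma open_hball: "open (hball n \<phi>)"
  unfolding hball_def by (rule open_hsemi_ball)

lemma hball_antimono: "m \<le> n \<Longrightarrow> hball n \<phi> \<subseteq> hball m \<phi>"
  unfolding hball_def
proof safe
  fix \<psi> assume mn: "m \<le> n" and *: "hsemi n (\<psi> - \<phi>) < 1 / real (Suc n)"
  have "1 / real (Suc n) \<le> 1 / real (Suc m)" using mn by (intro divide_left_mono) auto
  with * show "hsemi m (\<psi> - \<phi>) < 1 / real (Suc m)"
    using hsemi_mono[OF mn, of "\<psi> - \<phi>"] by linarith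
qed

text \<open>The ball of index \<open>2 * n + 1\<close> has radius \<open>1 / (2 * n + 2)\<close>,
  half of that of index \<open>n\<close>. This is the triangle inequality in terms of indices: one
  half moves the centre, the other reaches the point.\<close>

lemma hball_half_subset:
  assumes "\<psi> \<in> hball (2 * n + 1) \<phi>"
  shows "hball (2 * n + 1) \<psi> \<subseteq> hball n \<phi>"
proof
  fix \<zeta> assume \<zeta>: "\<zeta> \<in> hball (2 * n + 1) \<psi>"
  have "hsemi n (\<zeta> - \<phi>) \<le> hsemi n (\<zeta> - \<psi>) + hsemi n (\<psi> - \<phi>)"
    by (rule hsemi_diff_triangle)
  also have "\<dots> \<le> hsemi (2 * n + 1) (\<zeta> - \<psi>) + hsemi (2 * n + 1) (\<psi> - \<phi>)"
    by (intro add_mono hsemi_mono) auto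
  also have "\<dots> < 1 / real (Suc (2 * n + 1)) + 1 / real (Suc (2 * n + 1))"
    using assms \<zeta> unfolding hball_def by (intro add_strict_mono) auto
  also have "\<dots> = 1 / real (Suc n)" by (simp add: field_simps)
  finally show "\<zeta> \<in> hball n \<phi>" by (simp add: hball_def)
qed

lemma ex_hball_subset:
  assumes "0 < e"
  shows "\<exists>n. \<forall>\<phi>. hball n \<phi> \<subseteq> {\<psi>. hsemi j (\<psi> - \<phi>) < e}"
proof -
  obtain m where m: "inverse (real (Suc m)) < e" using reals_Archimedean[OF assms] by blast
  have "hsemi j (\<psi> - \<phi>) < e" if "\<psi> \<in> hball (max m j) \<phi>" for \<phi> \<psi> :: "'a history"
  proof -
    have "hsemi j (\<psi> - \<phi>) \<le> hsemi (max m j) (\<psi> - \<phi>)" by (rule hsemi_mono) simp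
    also have "\<dots> < 1 / real (Suc (max m j))" using that by (simp add: hball_def)
    also have "\<dots> \<le> 1 / real (Suc m)" by (intro divide_left_mono) auto
    finally show ?thesis using m by (simp add: inverse_eq_divide)
  qed
  then show ?thesis by blast
qed

text \<open>Coupling the radius to the index merges the choice of a seminorm and of a radius into
  one natural number. The balls are a decreasing countable neighbourhood base.\<close>

lemma open_history_iff_hball: "open U \<longleftrightarrow> (\<forall>\<phi>\<in>U. \<exists>n. hball n \<phi> \<subseteq> U)"
proof
  assume "open U"
  show "\<forall>\<phi>\<in>U. \<exists>n. hball n \<phi> \<subseteq> U"
  proof
    fix \<phi> assume "\<phi> \<in> U"
    then obtain j e where "0 < e" "\<forall>\<psi>. hsemi j (\<psi> - \<phi>) < e \<longrightarrow> \<psi> \<in> U"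
      using \<open>open U\<close> unfolding open_history_def by blast
    then show "\<exists>n. hball n \<phi> \<subseteq> U" using ex_hball_subset[of e j] by (metis (lifting) mem_Collect_eq subset_iff)
  qed
next
  assume *: "\<forall>\<phi>\<in>U. \<exists>n. hball n \<phi> \<subseteq> U"
  show "open U" unfolding open_history_def
  proof
    fix \<phi> assume "\<phi> \<in> U"
    then obtain n where "hball n \<phi> \<subseteq> U" using * by blast
    then show "\<exists>j. \<exists>e>0. \<forall>\<psi>. hsemi j (\<psi> - \<phi>) < e \<longrightarrow> \<psi> \<in> U"
      unfolding hball_def by (intro exI[of _ n] exI[of _ "1 / real (Suc n)"]) auto
  qed
qed

lemma eventually_nhds_history: "eventually P (nhds \<phi>) \<longleftrightarrow> (\<exists>n. \<forall>\<psi>\<in>hball n \<phi>. P \<psi>)"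
  unfolding eventually_nhds
  by (metis center_in_hball open_hball open_history_iff_hball subset_iff)

text \<open>One index serves both factors because the balls decrease. Negated, this yields the
  sequences in the proof of \<open>C1_F_imp_C1_MB\<close>.\<close>

lemma eventually_nhds_history_pair:
  "eventually P (nhds \<phi> \<times>\<^sub>F nhds \<psi>) \<longleftrightarrow> (\<exists>n. \<forall>\<phi>'\<in>hball n \<phi>. \<forall>\<psi>'\<in>hball n \<psi>. P (\<phi>', \<psi>'))"
proof
  assume "eventually P (nhds \<phi> \<times>\<^sub>F nhds \<psi>)"
  then obtain Q R where "eventually Q (nhds \<phi>)" "eventually R (nhds \<psi>)"
    and QR: "\<And>x y. Q x \<Longrightarrow> R y \<Longrightarrow> P (x, y)" unfolding eventually_prod_filter by blast
  then obtain m n where "\<forall>\<psi>\<in>hball m \<phi>. Q \<psi>" "\<forall>\<phi>\<in>hball n \<psi>. R \<phi>"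
    unfolding eventually_nhds_history by blast
  then show "\<exists>n. \<forall>\<phi>'\<in>hball n \<phi>. \<forall>\<psi>'\<in>hball n \<psi>. P (\<phi>', \<psi>')"
    using QR hball_antimono[of m "max m n" \<phi>] hball_antimono[of n "max m n" \<psi>]
    by (intro exI[of _ "max m n"]) (auto simp: subset_iff)
next
  assume "\<exists>n. \<forall>\<phi>'\<in>hball n \<phi>. \<forall>\<psi>'\<in>hball n \<psi>. P (\<phi>', \<psi>')"
  then obtain n where "\<And>\<phi>' \<psi>'. \<phi>' \<in> hball n \<phi> \<Longrightarrow> \<psi>' \<in> hball n \<psi> \<Longrightarrow> P (\<phi>', \<psi>')" by blast
  moreover have "eventually (\<lambda>\<phi>'. \<phi>' \<in> hball n \<phi>) (nhds \<phi>)" "eventually (\<lambda>\<psi>'. \<psi>' \<in> hball n \<psi>) (nhds \<psi>)"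
    unfolding eventually_nhds_history by blast+
  ultimately show "eventually P (nhds \<phi> \<times>\<^sub>F nhds \<psi>)" unfolding eventually_prod_filter by blast
qed

text \<open>Convexity of the balls: the mean value estimate can run along the line between two
  points of a ball.\<close>

lemma hsemi_convex_comb:
  assumes "0 \<le> \<theta>" "\<theta> \<le> 1" "hsemi n \<phi> < r" "hsemi n \<psi> < r"
  shows "hsemi n ((1 - \<theta>) *\<^sub>R \<phi> + \<theta> *\<^sub>R \<psi>) < r"
proof -
  have "hsemi n ((1 - \<theta>) *\<^sub>R \<phi> + \<theta> *\<^sub>R \<psi>) \<le> (1 - \<theta>) * hsemi n \<phi> + \<theta> * hsemi n \<psi>"
    using hsemi_triangle[of n "(1 - \<theta>) *\<^sub>R \<phi>" "\<theta> *\<^sub>R \<psi>"] assms by (simp add: hsemi_scaleR)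
  also have "\<dots> < r" using assms by (intro convex_bound_lt) auto
  finally show ?thesis .
qed

section \<open>Segments of continuous functions\<close>

lemma hsemi_segment_diff_le:
  assumes "continuous_on {..t} x" "continuous_on {..t} y" "\<And>r. t - real n \<le> r \<Longrightarrow> r \<le> t \<Longrightarrow> norm (x r - y r) \<le> B"
  shows "hsemi n (segment x t - segment y t) \<le> B"
proof (rule hsemi_le)
  fix s assume "- real n \<le> s" "s \<le> 0"
  then show "norm (happly (segment x t - segment y t) s) \<le> B"
    using assms(3)[of "t + s"] by (simp add: happly_simps happly_segment assms(1,2))
qed

lemma norm_le_hsemi_segment_diff:
  assumes "continuous_on {..t} x" "continuous_on {..t} y" "t - real n \<le> r" "r \<le> t"
  shows "norm (x r - y r) \<le> hsemi n (segment x t - segment y t)"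
  using norm_le_hsemi[of n "r - t" "segment x t - segment y t"] assms
  by (simp add: happly_simps happly_segment)

lemma segment_eqI:
  assumes "continuous_on {..t} x" "\<And>s. s \<le> 0 \<Longrightarrow> happly \<phi> s = x (t + s)"
  shows "segment x t = \<phi>"
  by (rule history_eqI) (simp add: happly_segment assms)

lemma segment_const_0: "segment (\<lambda>_. 0) t = 0"
  by (rule segment_eqI) (auto simp: happly_simps)

lemma segment_cong:
  assumes "\<And>r. r \<le> t \<Longrightarrow> x r = y r"
  shows "segment x t = segment y t"
  unfolding segment_def by (rule arg_cong[where f=Abs_history]) (auto intro!: ext assms)

lemma continuous_on_segment:
  assumes "continuous_on {..T} x"
  shows "continuous_on {..T} (segment x)"
  unfolding continuous_on_def tendsto_history_iff
proof (intro ballI allI)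
  fix t j assume t: "t \<in> {..T}"
  \<comment> \<open>The window reaches one unit further back than \<open>t - j\<close>, so it
    contains \<open>s + r\<close> for all \<open>s\<close> within distance \<open>1\<close> of
    \<open>t\<close> and all \<open>r \<ge> - j\<close>.\<close>
  let ?K = "{t - real j - 1..T}"
  have K: "uniformly_continuous_on ?K x"
    by (rule compact_uniformly_continuous[OF continuous_on_subset[OF assms]]) auto
  show "((\<lambda>s. hsemi j (segment x s - segment x t)) \<longlongrightarrow> 0) (at t within {..T})"
  proof (rule tendstoI)
    fix e :: real assume e: "0 < e"
    obtain d where d: "0 < d" "\<And>r r'. r \<in> ?K \<Longrightarrow> r' \<in> ?K \<Longrightarrow> dist r' r < d \<Longrightarrow> dist (x r') (x r) < e / 2"
      using K e unfolding uniformly_continuous_on_def by (metis half_gt_zero)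
    have "\<forall>\<^sub>F s in at t within {..T}. s \<in> {..T} \<and> dist s t < min d 1"
      unfolding eventually_at using d(1) by (intro exI[of _ "min d 1"]) auto
    then show "\<forall>\<^sub>F s in at t within {..T}. dist (hsemi j (segment x s - segment x t)) 0 < e"
    proof eventually_elim
      case (elim s)
      have "hsemi j (segment x s - segment x t) \<le> e / 2"
      proof (rule hsemi_le)
        fix r assume r: "- real j \<le> r" "r \<le> 0"
        have "dist (x (s + r)) (x (t + r)) < e / 2"
          using r elim t by (intro d(2)) (auto simp: dist_real_def)
        then show "norm (happly (segment x s - segment x t) r) \<le> e / 2"
          using elim t r continuous_on_subset[OF assms]
          by (simp add: happly_simps happly_segment dist_norm)
      qed
      then show ?case using e by (simp add: hsemi_nonneg)
    qed
  qed
qed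

lemma segment_diff:
  assumes "continuous_on {..t} x" "continuous_on {..t} y"
  shows "segment (\<lambda>r. x r - y r) t = segment x t - segment y t"
  by (rule segment_eqI) (auto intro!: continuous_intros assms simp: happly_simps happly_segment assms)

lemma segment_add_scaleR:
  assumes "continuous_on {..t} x" "continuous_on {..t} y"
  shows "segment (\<lambda>r. x r + c *\<^sub>R y r) t = segment x t + c *\<^sub>R segment y t"
  by (rule segment_eqI) (auto intro!: continuous_intros assms simp: happly_simps happly_segment assms)

text \<open>Absorption by neighbourhoods becomes a family of real bounds, the form in which
  estimates of solutions deliver boundedness.\<close>

lemma tvs_bounded_history_iff:
  "tvs_bounded B \<longleftrightarrow> (\<forall>k. bdd_above (hsemi k ` (B::'b::real_normed_vector history set)))"
proof
  assume B: "tvs_bounded B"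
  show "\<forall>k. bdd_above (hsemi k ` B)"
  proof
    fix k
    have "open {\<psi> :: 'b history. hsemi k (\<psi> - 0) < 1}" "(0 :: 'b history) \<in> {\<psi>. hsemi k (\<psi> - 0) < 1}"
      by (rule open_hsemi_ball) (simp add: hsemi_zero)
    then obtain r where r: "r > 0" "\<forall>s\<ge>r. B \<subseteq> (*\<^sub>R) s ` {\<psi>. hsemi k (\<psi> - 0) < 1}"
      using B unfolding tvs_bounded_def by meson
    have "hsemi k \<phi> \<le> r" if "\<phi> \<in> B" for \<phi>
    proof -
      have "\<phi> \<in> (*\<^sub>R) r ` {\<psi>. hsemi k (\<psi> - 0) < 1}" using r that by blast
      then obtain \<psi> where "\<phi> = r *\<^sub>R \<psi>" "hsemi k \<psi> < 1" by auto
      then show ?thesis using r(1) by (simp add: hsemi_scaleR)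
    qed
    then show "bdd_above (hsemi k ` B)" by (auto intro!: bdd_aboveI)
  qed
next
  assume B: "\<forall>k. bdd_above (hsemi k ` B)"
  show "tvs_bounded B" unfolding tvs_bounded_def
  proof (intro allI impI)
    fix N :: "'b history set" assume N: "open N \<and> 0 \<in> N"
    then obtain n where n: "hball n 0 \<subseteq> N" unfolding open_history_iff_hball by blast
    obtain M where M: "\<And>\<phi>. \<phi> \<in> B \<Longrightarrow> hsemi n \<phi> \<le> M"
      using B unfolding bdd_above_def by (metis imageI)
    \<comment> \<open>Dividing by \<open>r\<close> brings the bound \<open>M\<close> below the
      radius \<open>1 / (n + 1)\<close> of the ball; the summand \<open>1\<close> makes the
      inequality strict.\<close>
    define r where "r = (\<bar>M\<bar> + 1) * real (Suc n)"
    have r: "0 < r" unfolding r_def by (intro mult_pos_pos) auto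
    have "\<phi> \<in> (*\<^sub>R) s ` N" if "s \<ge> r" "\<phi> \<in> B" for s \<phi>
    proof
      have s: "0 < s" using r that(1) by linarith
      then show "\<phi> = s *\<^sub>R (\<phi> /\<^sub>R s)" by simp
      have "hsemi n \<phi> * real (Suc n) < r" unfolding r_def
        using M[OF that(2)] by (intro mult_strict_right_mono) auto
      then have "hsemi n \<phi> * real (Suc n) < s" using that(1) by linarith
      then have "\<phi> /\<^sub>R s \<in> hball n 0" using s
        by (simp add: hball_def hsemi_scaleR field_simps)
      then show "\<phi> /\<^sub>R s \<in> N" using n by blast
    qed
    then show "\<exists>r>0. \<forall>s\<ge>r. B \<subseteq> (*\<^sub>R) s ` N" using r by blast
  qed
qed

section \<open>A Gronwall estimate and successive approximation for delay equations\<close>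

text \<open>Adapts \<open>differentiable_bound_general\<close> to derivatives within a closed
  interval, as solutions have them, and to \<open>a = b\<close>.\<close>

lemma norm_diff_le_by_derivative:
  fixes d :: "real \<Rightarrow> 'b::real_normed_vector"
  assumes "a \<le> b"
    and d: "\<And>t. t \<in> {a..b} \<Longrightarrow> (d has_vector_derivative d' t) (at t within {a..b})"
    and g: "\<And>t. t \<in> {a..b} \<Longrightarrow> (g has_vector_derivative g' t) (at t within {a..b})"
    and le: "\<And>t. t \<in> {a..b} \<Longrightarrow> norm (d' t) \<le> g' t"
  shows "norm (d b - d a) \<le> g b - g a"
proof (cases "a = b")
  case False
  show ?thesis
  proof (rule differentiable_bound_general)
    show "continuous_on {a..b} d" "continuous_on {a..b} g"
      by (rule continuous_on_vector_derivative, erule d, rule continuous_on_vector_derivative, erule g)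
    show "norm (d' t) \<le> g' t" if "a < t" "t < b" for t using le that by auto
    show "(d has_vector_derivative d' t) (at t)" "(g has_vector_derivative g' t) (at t)"
      if "a < t" "t < b" for t using d[of t] g[of t] that by (auto simp: at_within_Icc_at)
  qed (use assms False in auto)
qed simp

text \<open>The constant of \<open>delay_gronwall\<close>. The exponential removes the weight, and
  the factor \<open>2\<close> comes from absorbing half of the weighted maximum.\<close>

definition growth :: "real \<Rightarrow> real \<Rightarrow> real" where
  "growth L T = 2 * (1 + L * T + T) * exp ((2 * L + 1) * T)"

lemma growth_mono: "0 \<le> L \<Longrightarrow> 0 \<le> t \<Longrightarrow> t \<le> T \<Longrightarrow> growth L t \<le> growth L T"
  unfolding growth_def by (intro mult_mono) (auto intro!: mult_left_mono add_mono)

lemma growth_ge_1: "0 \<le> L \<Longrightarrow> 0 \<le> T \<Longrightarrow> 1 \<le> growth L T"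
  using growth_mono[of L 0 T] by (simp add: growth_def)

text \<open>The supremum of \<open>exp (- c * t) * norm (d t)\<close> with \<open>c = 2 * L + 1\<close> is bounded in terms of
  half of itself.\<close>

lemma delay_gronwall:
  fixes d :: "real \<Rightarrow> 'b::real_normed_vector"
  assumes L: "0 \<le> L" and e: "0 \<le> e" and cont: "continuous_on {..T} d"
    and init: "\<And>t. - real n \<le> t \<Longrightarrow> t \<le> 0 \<Longrightarrow> norm (d t) \<le> a"
    and der: "\<And>t. t \<in> {0..T} \<Longrightarrow> (d has_vector_derivative d' t) (at t within {0..T})"
    and le: "\<And>t. t \<in> {0..T} \<Longrightarrow> norm (d' t) \<le> L * hsemi n (segment d t) + e"
    and t: "t \<in> {0..T}"
  shows "norm (d t) \<le> growth L T * (a + e)"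
proof -
  define c where "c = 2 * L + 1"
  have c: "0 < c" "L / c \<le> 1 / 2" using L unfolding c_def by auto
  have a: "norm (d 0) \<le> a" using init[of 0] by simp
  then have a0: "0 \<le> a" using norm_ge_zero[of "d 0"] by linarith
  have T: "0 \<le> T" using t by simp
  have "continuous_on {0..T} (\<lambda>t. exp (- c * t) * norm (d t))"
    by (intro continuous_intros continuous_on_subset[OF cont]) auto
  then obtain s where s: "s \<in> {0..T}" and
    max: "\<And>t. t \<in> {0..T} \<Longrightarrow> exp (- c * t) * norm (d t) \<le> exp (- c * s) * norm (d s)"
    using continuous_attains_sup[of "{0..T}" "\<lambda>t. exp (- c * t) * norm (d t)"] t by auto
  define K where "K = exp (- c * s) * norm (d s)"
  have K: "0 \<le> K" unfolding K_def by simp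
  have dK: "norm (d t) \<le> K * exp (c * t)" if "t \<in> {0..T}" for t
    using max[OF that] unfolding K_def[symmetric] by (simp add: exp_minus field_simps)
  have hK: "norm (d' t) \<le> (L * a + e) + L * K * exp (c * t)" if "t \<in> {0..T}" for t
  proof -
    have ct: "continuous_on {..t} d" by (rule continuous_on_subset[OF cont]) (use that in auto)
    \<comment> \<open>The window of the segment is split at time \<open>0\<close>: the past is
      bounded by \<open>a\<close>, the rest by \<open>K * exp (c * t)\<close>, and the sum dominates
      both.\<close>
    have "hsemi n (segment d t) \<le> a + K * exp (c * t)"
    proof (rule hsemi_le)
      fix r assume r: "- real n \<le> r" "r \<le> 0"
      have "norm (d (t + r)) \<le> a + K * exp (c * t)"
      proof (cases "t + r \<le> 0")
        case True
        then have "norm (d (t + r)) \<le> a" using r that by (intro init) auto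
        then show ?thesis using K by (simp add: add_increasing2)
      next
        case False
        then have "norm (d (t + r)) \<le> K * exp (c * (t + r))" using r that by (intro dK) auto
        also have "\<dots> \<le> K * exp (c * t)" using r K c by (intro mult_left_mono) auto
        finally show ?thesis using a0 by simp
      qed
      then show "norm (happly (segment d t) r) \<le> a + K * exp (c * t)"
        using r by (simp add: happly_segment[OF ct])
    qed
    then have "L * hsemi n (segment d t) + e \<le> L * (a + K * exp (c * t)) + e"
      using L by (intro add_right_mono mult_left_mono)
    with le[OF that] show ?thesis by (simp add: algebra_simps)
  qed
  \<comment> \<open>A primitive of the bound \<open>hK\<close> on the derivative; integration
    produces the small factor \<open>L / c\<close>.\<close>
  define g where "g t = (L * a + e) * t + L / c * K * exp (c * t)" for t
  have "norm (d s - d 0) \<le> g s - g 0"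
  proof (rule norm_diff_le_by_derivative)
    fix t assume "t \<in> {0..s}"
    then have "t \<in> {0..T}" using s by simp
    show "(d has_vector_derivative d' t) (at t within {0..s})"
      by (rule has_vector_derivative_within_subset[OF der[OF \<open>t \<in> {0..T}\<close>]]) (use s in auto)
    show "norm (d' t) \<le> (L * a + e) + L * K * exp (c * t)" by (rule hK) fact
    show "(g has_vector_derivative (L * a + e) + L * K * exp (c * t)) (at t within {0..s})"
      unfolding g_def has_real_derivative_iff_has_vector_derivative[symmetric]
      using c by (auto intro!: derivative_eq_intros)
  qed (use s in auto)
  also have "g s - g 0 \<le> (L * a + e) * T + 1 / 2 * (K * exp (c * s))"
  proof -
    have "(L * a + e) * s \<le> (L * a + e) * T" using s L a0 e by (intro mult_left_mono) auto
    moreover have "L / c * (K * exp (c * s)) \<le> 1 / 2 * (K * exp (c * s))"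
      using c K by (intro mult_right_mono) auto
    moreover have "0 \<le> L / c * K" using L c K by simp
    moreover have "g s - g 0 = (L * a + e) * s + L / c * (K * exp (c * s)) - L / c * K"
      unfolding g_def by simp
    ultimately show ?thesis by linarith
  qed
  finally have "norm (d s - d 0) \<le> (L * a + e) * T + 1 / 2 * (K * exp (c * s))" .
  moreover have "K * exp (c * s) = norm (d s)" unfolding K_def by (simp add: exp_minus)
  ultimately have "K * exp (c * s) \<le> 2 * (a + (L * a + e) * T)"
    using a norm_triangle_sub[of "d s" "d 0"] by simp
  moreover have "K * 1 \<le> K * exp (c * s)" using K s c by (intro mult_left_mono) auto
  ultimately have "K \<le> 2 * (a + (L * a + e) * T)" by simp
  also have "\<dots> \<le> 2 * (1 + L * T + T) * (a + e)"
    using a0 e L T by (auto simp: algebra_simps intro!: add_nonneg_nonneg mult_nonneg_nonneg)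
  finally have "K * exp (c * t) \<le> 2 * (1 + L * T + T) * (a + e) * exp (c * T)"
    using t c a0 e L T by (intro mult_mono) auto
  then show ?thesis using dK[OF t] unfolding growth_def c_def by (simp add: mult_ac)
qed

text \<open>An exponential weight makes the integral operator a contraction on all of
  \<open>{0..T}\<close> at once, so no continuation in small time steps occurs. The right-hand side
  \<open>\<Phi>\<close> is an operator on whole functions, which covers both the retracted nonlinear
  equation and the linearized one. The case \<open>B = 0\<close> of the Lipschitz hypothesis says
  that \<open>\<Phi> y s\<close> depends only on \<open>y\<close> up to time
  \<open>s\<close>.\<close>

lemma picard_existence:
  fixes \<Phi> :: "(real \<Rightarrow> 'b) \<Rightarrow> real \<Rightarrow> 'b::euclidean_space" and \<phi> :: "'b history"
  assumes T: "0 \<le> T" and L: "0 \<le> L"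
    and cont: "\<And>y. continuous_on UNIV y \<Longrightarrow> continuous_on {0..T} (\<Phi> y)"
    and lip: "\<And>y y' s B. continuous_on UNIV y \<Longrightarrow> continuous_on UNIV y' \<Longrightarrow> s \<in> {0..T} \<Longrightarrow>
      (\<And>r. r \<le> s \<Longrightarrow> norm (y r - y' r) \<le> B) \<Longrightarrow> norm (\<Phi> y s - \<Phi> y' s) \<le> L * B"
  obtains y where "continuous_on UNIV y" "segment y 0 = \<phi>"
    "\<And>t. t \<in> {0..T} \<Longrightarrow> (y has_vector_derivative \<Phi> y t) (at t within {0..T})"
proof -
  \<comment> \<open>The functions \<open>Y z\<close> and \<open>Y z'\<close> below differ by at most
    \<open>2 * exp (c * s)\<close> times the distance of \<open>z\<close> and \<open>z'\<close>, so
    the integrand has Lipschitz constant \<open>2 * L\<close>, and integration against the weight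
    divides by \<open>c\<close>.\<close>
  define c where "c = 4 * L + 1"
  have c: "0 < c" "2 * L / c \<le> 1 / 2" using L unfolding c_def by auto
  \<comment> \<open>Retraction of the line onto \<open>{0..T}\<close>: composition with
    \<open>p\<close> turns functions on \<open>{0..T}\<close> into bounded continuous functions on
    the line.\<close>
  define p where "p t = max 0 (min T t)" for t :: real
  have p: "p t \<in> {0..T}" for t unfolding p_def using T by auto
  have p_id: "t \<in> {0..T} \<Longrightarrow> p t = t" for t unfolding p_def by auto
  have p_0: "t \<le> 0 \<Longrightarrow> p t = 0" for t unfolding p_def using T by auto
  have p_cont: "continuous_on S p" for S unfolding p_def by (intro continuous_intros)
  \<comment> \<open>The candidate solution: the initial history up to time \<open>0\<close>, then
    the increment with its weight removed. Subtracting the value of \<open>z\<close> at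
    \<open>0\<close> gives \<open>Y z\<close> the history \<open>\<phi>\<close> for every
    \<open>z\<close>, not only for the fixed point, whose value at \<open>0\<close> is
    \<open>0\<close>.\<close>
  define Y where "Y z t = happly \<phi> (min t 0) + (exp (c * p t) *\<^sub>R apply_bcontfun z (p t) - apply_bcontfun z 0)"
    for z :: "real \<Rightarrow>\<^sub>C 'b" and t
  have z_cont: "continuous_on S (\<lambda>t. apply_bcontfun z (p t))" for z :: "real \<Rightarrow>\<^sub>C 'b" and S
    by (rule continuous_on_compose2[of UNIV]) (auto intro: p_cont)
  have Y_cont: "continuous_on UNIV (Y z)" for z
    unfolding Y_def
    by (intro continuous_intros z_cont p_cont continuous_on_compose2[OF continuous_on_happly]) auto
  define I where "I z t = integral {0..t} (\<Phi> (Y z))" for z t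
  have I_der: "(I z has_vector_derivative \<Phi> (Y z) t) (at t within {0..T})" if "t \<in> {0..T}" for z t
    unfolding I_def using cont[OF Y_cont] that by (rule integral_has_vector_derivative)
  have I_cont: "continuous_on {0..T} (I z)" for z
    using I_der by (rule continuous_on_vector_derivative)
  \<comment> \<open>The weighted integral. On \<open>{0..T}\<close> the equation
    \<open>H z = z\<close> is the integral equation for \<open>Y z\<close>.\<close>
  define H where "H z t = exp (- c * p t) *\<^sub>R I z (p t)" for z t
  have H_bcontfun: "H z \<in> bcontfun" for z
    unfolding bcontfun_def
  proof safe
    show "continuous_on UNIV (H z)" unfolding H_def
      by (intro continuous_intros p_cont continuous_on_compose2[OF I_cont p_cont]) (use p in auto)
    have "compact ((\<lambda>t. exp (- c * t) *\<^sub>R I z t) ` {0..T})"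
      by (intro compact_continuous_image continuous_intros I_cont compact_Icc)
    moreover have "range (H z) \<subseteq> (\<lambda>t. exp (- c * t) *\<^sub>R I z t) ` {0..T}"
      unfolding H_def using p by (auto intro!: image_eqI)
    ultimately show "bounded (range (H z))" by (meson bounded_subset compact_imp_bounded)
  qed
  have H_apply: "apply_bcontfun (Bcontfun (H z)) = H z" for z
    using H_bcontfun by (rule Bcontfun_inverse)
  have contraction: "dist (Bcontfun (H z)) (Bcontfun (H z')) \<le> 1 / 2 * dist z z'" for z z'
  proof (rule dist_bound)
    fix t
    define D where "D = dist z z'"
    have D: "norm (apply_bcontfun z r - apply_bcontfun z' r) \<le> D" for r
      unfolding D_def using dist_bounded[of z r z'] by (simp add: dist_norm)
    have D0: "0 \<le> D" unfolding D_def by simp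
    have lipI: "norm (\<Phi> (Y z) s - \<Phi> (Y z') s) \<le> 2 * L * D * exp (c * s)" if s: "s \<in> {0..T}" for s
    proof -
      have "norm (Y z r - Y z' r) \<le> 2 * D * exp (c * s)" if "r \<le> s" for r
      proof -
        have "Y z r - Y z' r = exp (c * p r) *\<^sub>R (apply_bcontfun z (p r) - apply_bcontfun z' (p r)) -
            (apply_bcontfun z 0 - apply_bcontfun z' 0)"
          unfolding Y_def by (simp add: algebra_simps)
        also have "norm \<dots> \<le> exp (c * p r) * D + D"
          by (rule order_trans[OF norm_triangle_ineq4], rule add_mono[OF _ D]) (simp add: D)
        also have "\<dots> \<le> exp (c * s) * D + exp (c * s) * D"
        proof (intro add_mono)
          show "exp (c * p r) * D \<le> exp (c * s) * D"
            using that s c D0 unfolding p_def by (intro mult_right_mono) auto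
          have "1 * D \<le> exp (c * s) * D" using s c D0 by (intro mult_right_mono) auto
          then show "D \<le> exp (c * s) * D" by simp
        qed
        finally show ?thesis by (simp add: algebra_simps)
      qed
      from lip[OF Y_cont Y_cont s this] show ?thesis by (simp add: mult_ac)
    qed
    have "norm ((I z (p t) - I z' (p t)) - (I z 0 - I z' 0)) \<le>
        2 * L / c * D * exp (c * p t) - 2 * L / c * D * exp (c * 0)"
    proof (rule norm_diff_le_by_derivative[where d="\<lambda>s. I z s - I z' s" and g="\<lambda>s. 2 * L / c * D * exp (c * s)"])
      fix s assume "s \<in> {0..p t}"
      then have s: "s \<in> {0..T}" using p[of t] by auto
      show "((\<lambda>s. I z s - I z' s) has_vector_derivative (\<Phi> (Y z) s - \<Phi> (Y z') s)) (at s within {0..p t})"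
        by (rule has_vector_derivative_within_subset[OF has_vector_derivative_diff[OF I_der[OF s] I_der[OF s]]])
          (use p[of t] in auto)
      show "((\<lambda>s. 2 * L / c * D * exp (c * s)) has_vector_derivative 2 * L * D * exp (c * s)) (at s within {0..p t})"
        unfolding has_real_derivative_iff_has_vector_derivative[symmetric]
        using c by (auto intro!: derivative_eq_intros)
      show "norm (\<Phi> (Y z) s - \<Phi> (Y z') s) \<le> 2 * L * D * exp (c * s)" by (rule lipI[OF s])
    qed (use p[of t] in auto)
    also have "\<dots> \<le> 2 * L / c * (D * exp (c * p t))" using L c D0 by (simp add: mult_ac)
    also have "\<dots> \<le> 1 / 2 * (D * exp (c * p t))" using c D0 by (intro mult_right_mono) auto
    finally have "norm (I z (p t) - I z' (p t)) \<le> 1 / 2 * (D * exp (c * p t))" by (simp add: I_def)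
    then have "exp (- c * p t) * norm (I z (p t) - I z' (p t)) \<le> 1 / 2 * D"
      by (simp add: exp_minus field_simps)
    then show "dist (apply_bcontfun (Bcontfun (H z)) t) (apply_bcontfun (Bcontfun (H z')) t) \<le> 1 / 2 * dist z z'"
      unfolding H_apply unfolding H_def D_def dist_norm scaleR_diff_right[symmetric] by simp
  qed
  obtain z where z: "Bcontfun (H z) = z"
    using banach_fix_type[of "1/2" "\<lambda>z. Bcontfun (H z)"] contraction by auto
  have z_apply: "apply_bcontfun z t = H z t" for t using H_apply[of z] z by simp
  have z0: "apply_bcontfun z 0 = 0" unfolding z_apply H_def using p_0[of 0] by (simp add: I_def)
  have Y_eq: "Y z t = happly \<phi> 0 + I z t" if "t \<in> {0..T}" for t
    using that unfolding Y_def z0 unfolding z_apply H_def by (simp add: p_id exp_minus)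
  show ?thesis
  proof (rule that)
    show "continuous_on UNIV (Y z)" by (rule Y_cont)
    show "segment (Y z) 0 = \<phi>"
      by (rule segment_eqI[OF continuous_on_subset[OF Y_cont]]) (auto simp: Y_def p_0)
    fix t assume t: "t \<in> {0..T}"
    have "((\<lambda>t. happly \<phi> 0 + I z t) has_vector_derivative 0 + \<Phi> (Y z) t) (at t within {0..T})"
      by (intro has_vector_derivative_add has_vector_derivative_const I_der t)
    then show "(Y z has_vector_derivative \<Phi> (Y z) t) (at t within {0..T})"
      using t Y_eq by (auto intro: has_vector_derivative_transform)
  qed
qed

section \<open>Calculus of directional derivatives\<close>

lemma dir_deriv_tendsto:
  assumes "dir_differentiable g u v"
  shows "((\<lambda>t. (1 / t) *\<^sub>R (g (u + t *\<^sub>R v) - g u)) \<longlongrightarrow> dir_deriv g u v) (at 0)"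
proof -
  obtain w where w: "((\<lambda>t::real. (1 / t) *\<^sub>R (g (u + t *\<^sub>R v) - g u)) \<longlongrightarrow> w) (at 0)"
    using assms unfolding dir_differentiable_def by blast
  moreover from this have "dir_deriv g u v = w" unfolding dir_deriv_def by (intro tendsto_Lim) auto
  ultimately show ?thesis by simp
qed

lemma dir_derivI:
  assumes "((\<lambda>t. (1 / t) *\<^sub>R (g (u + t *\<^sub>R v) - g u)) \<longlongrightarrow> w) (at 0)"
  shows "dir_differentiable g u v" "dir_deriv g u v = w"
  using assms unfolding dir_differentiable_def dir_deriv_def
  by (auto intro: tendsto_Lim)

text \<open>Links the quotients that define \<open>dir_deriv\<close> to ordinary derivatives along
  lines, so that the mean value inequality and the chain rule apply.\<close>

lemma has_vector_derivative_at_iff_quotient: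
  fixes g :: "real \<Rightarrow> 'b::real_normed_vector"
  shows "(g has_vector_derivative w) (at s) \<longleftrightarrow> ((\<lambda>t. (1 / t) *\<^sub>R (g (s + t) - g s)) \<longlongrightarrow> w) (at 0)"
proof -
  have "norm ((1 / t) *\<^sub>R (g (s + t) - g s) - w) = norm (g (s + t) - g s - t *\<^sub>R w) / norm t" if "t \<noteq> 0" for t
  proof -
    have "(1 / t) *\<^sub>R (g (s + t) - g s) - w = (1 / t) *\<^sub>R (g (s + t) - g s - t *\<^sub>R w)"
      using that by (simp add: algebra_simps)
    then show ?thesis by (simp add: divide_simps)
  qed
  then have "((\<lambda>t. norm ((1 / t) *\<^sub>R (g (s + t) - g s) - w)) \<longlongrightarrow> 0) (at 0) \<longleftrightarrow>
      ((\<lambda>t. norm (g (s + t) - g s - t *\<^sub>R w) / norm t) \<longlongrightarrow> 0) (at 0)"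
    by (intro LIM_cong) auto
  then show ?thesis
    unfolding has_vector_derivative_def has_derivative_at
    by (simp add: bounded_linear_scaleR_left tendsto_norm_zero_iff LIM_zero_iff)
qed

text \<open>Finitely many neighbourhoods, each with its own index, cover the compact interval. By
  monotonicity the largest of these indices works everywhere.\<close>

lemma uniform_index:
  fixes S :: "real \<Rightarrow> nat \<Rightarrow> bool"
  assumes mono: "\<And>s m n. S s m \<Longrightarrow> m \<le> n \<Longrightarrow> S s n"
    and local: "\<And>s. s \<in> {a..b} \<Longrightarrow> \<exists>n. \<exists>d>0. \<forall>r\<in>{a..b}. \<bar>r - s\<bar> < d \<longrightarrow> S r n"
  shows "\<exists>n. \<forall>s\<in>{a..b}. S s n"
proof -
  obtain N D where D: "\<And>s. s \<in> {a..b} \<Longrightarrow> 0 < D s"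
    and N: "\<And>s r. s \<in> {a..b} \<Longrightarrow> r \<in> {a..b} \<Longrightarrow> \<bar>r - s\<bar> < D s \<Longrightarrow> S r (N s)"
    using local by metis
  have "{a..b} \<subseteq> (\<Union>s\<in>{a..b}. ball s (D s))" using D by auto
  then obtain C where C: "C \<subseteq> {a..b}" "finite C" "{a..b} \<subseteq> (\<Union>s\<in>C. ball s (D s))"
    using compactE_image[OF compact_Icc, of "{a..b}" "\<lambda>s. ball s (D s)"] by (metis open_ball)
  have "S r (Max (N ` C))" if r: "r \<in> {a..b}" for r
  proof -
    obtain s where s: "s \<in> C" "r \<in> ball s (D s)" using C(3) r by auto
    then have "S r (N s)" using N[of s r] C(1) r by (auto simp: dist_real_def abs_minus_commute)
    then show ?thesis using s(1) C(2) by (auto intro: mono)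
  qed
  then show ?thesis by blast
qed

lemma segment_near:
  assumes "continuous_on {..T} x" "s \<in> {0..T}"
  shows "\<exists>d>0. \<forall>r\<in>{0..T}. \<bar>r - s\<bar> < d \<longrightarrow> segment x r \<in> hball n (segment x s)"
proof -
  have "(segment x \<longlongrightarrow> segment x s) (at s within {..T})"
    using continuous_on_segment[OF assms(1)] assms(2) unfolding continuous_on_def by auto
  then have "\<forall>\<^sub>F r in at s within {..T}. segment x r \<in> hball n (segment x s)"
    by (rule topological_tendstoD) (auto intro: open_hball center_in_hball)
  then obtain d where "0 < d" and d: "\<And>r. r \<in> {..T} \<Longrightarrow> r \<noteq> s \<Longrightarrow> dist r s < d \<Longrightarrow> segment x r \<in> hball n (segment x s)"
    unfolding eventually_at by auto
  have "segment x r \<in> hball n (segment x s)" if "r \<in> {0..T}" "\<bar>r - s\<bar> < d" for r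
    using d[of r] that center_in_hball by (cases "r = s") (auto simp: dist_real_def)
  then show ?thesis using \<open>0 < d\<close> by blast
qed

text \<open>Extracts from continuity into \<open>Lc_topology\<close> an estimate that is uniform
  over one bounded set.\<close>

lemma C1_F_uniform:
  fixes f :: "'b::real_normed_vector history \<Rightarrow> 'c::real_normed_vector"
  assumes "C1_F U f" "\<phi> \<in> U" "tvs_bounded B" "0 < e"
  shows "\<exists>n. \<forall>\<psi>\<in>hball n \<phi>. \<psi> \<in> U \<and> (\<forall>v\<in>B. norm (dir_deriv f \<psi> v - dir_deriv f \<phi> v) < e)"
proof -
  let ?D = "dir_deriv f"
  \<comment> \<open>A pointwise bound \<open>< e\<close> on an infinite \<open>B\<close> need not
    define an open set. The common bound \<open>c < e\<close> leaves the margin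
    \<open>(e - c) / 2\<close> for perturbations.\<close>
  define W where "W = {A \<in> Lc. \<exists>c<e. \<forall>v\<in>B. norm (A v - ?D \<phi> v) \<le> c}"
  have "openin Lc_topology W"
    unfolding openin_Lc_topology
  proof (intro conjI ballI)
    show "W \<subseteq> Lc" unfolding W_def by auto
    fix A assume "A \<in> W"
    then obtain c where A: "A \<in> Lc" "c < e" "\<And>v. v \<in> B \<Longrightarrow> norm (A v - ?D \<phi> v) \<le> c"
      unfolding W_def by auto
    have "{A' \<in> Lc. \<forall>v\<in>B. A' v - A v \<in> ball 0 ((e - c) / 2)} \<subseteq> W"
      unfolding W_def
    proof safe
      fix A' assume A': "\<forall>v\<in>B. A' v - A v \<in> ball 0 ((e - c) / 2)"
      have "norm (A' v - ?D \<phi> v) \<le> (e + c) / 2" if "v \<in> B" for v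
      proof -
        have "norm (A' v - A v) < (e - c) / 2" using bspec[OF A' that] by simp
        then show ?thesis
          using norm_triangle_ineq[of "A' v - A v" "A v - ?D \<phi> v"] A(3)[OF that] by (simp add: field_simps)
      qed
      then show "\<exists>c<e. \<forall>v\<in>B. norm (A' v - ?D \<phi> v) \<le> c"
        using A(2) by (intro exI[of _ "(e + c) / 2"]) auto
    qed
    then show "\<exists>B N. tvs_bounded B \<and> open N \<and> 0 \<in> N \<and> {A'\<in>Lc. \<forall>v\<in>B. A' v - A v \<in> N} \<subseteq> W"
      using assms(3) A(2) by (intro exI[of _ B] exI[of _ "ball 0 ((e - c) / 2)"]) auto
  qed
  then have "openin (top_of_set U) {\<psi> \<in> U. ?D \<psi> \<in> W}"
    using assms(1) unfolding C1_F_def continuous_map_def by (auto simp: topspace_subtopology)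
  then have "open {\<psi> \<in> U. ?D \<psi> \<in> W}"
    using assms(1) unfolding C1_F_def by (meson openin_open_trans)
  moreover have "\<phi> \<in> {\<psi> \<in> U. ?D \<psi> \<in> W}"
    using assms unfolding W_def C1_F_def by (auto intro!: exI[of _ 0])
  ultimately obtain n where "hball n \<phi> \<subseteq> {\<psi> \<in> U. ?D \<psi> \<in> W}" unfolding open_history_iff_hball by blast
  then show ?thesis unfolding W_def by (intro exI[of _ n]) force
qed

text \<open>Evaluation is not jointly continuous on \<open>Lc\<close>, but it is along convergent sequences, whose
  terms form bounded sets; this suffices as the history space is first countable.\<close>

lemma C1_F_imp_C1_MB:
  fixes f :: "'b::real_normed_vector history \<Rightarrow> 'c::real_normed_vector"
  assumes "C1_F U f"
  shows "C1_MB U f"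
proof -
  let ?D = "dir_deriv f"
  have "((\<lambda>(u, v). ?D u v) \<longlongrightarrow> ?D u v) (nhds u \<times>\<^sub>F nhds v)" if u: "u \<in> U" for u v
  proof (rule tendstoI, rule ccontr)
    fix e :: real assume e: "0 < e"
    assume "\<not> (\<forall>\<^sub>F p in nhds u \<times>\<^sub>F nhds v. dist (case p of (u, v) \<Rightarrow> ?D u v) (?D u v) < e)"
    then have "\<forall>n. \<exists>u'\<in>hball n u. \<exists>v'\<in>hball n v. \<not> dist (?D u' v') (?D u v) < e"
      unfolding eventually_nhds_history_pair by auto
    then obtain us vs where us: "\<And>n. us n \<in> hball n u" and vs: "\<And>n. vs n \<in> hball n v"
      and far: "\<And>n. \<not> dist (?D (us n) (vs n)) (?D u v) < e" by metis
    have "tvs_bounded (range vs)" unfolding tvs_bounded_history_iff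
    proof
      fix k
      \<comment> \<open>For \<open>n > k\<close> the ball of index \<open>n\<close> controls the
        seminorm \<open>k\<close> and has radius at most \<open>1\<close>; the finitely many other
        terms are bounded by their sum.\<close>
      have "hsemi k (vs n) \<le> (\<Sum>i\<le>k. hsemi k (vs i)) + (1 + hsemi k v)" for n
      proof (cases "n \<le> k")
        case True
        then have "hsemi k (vs n) \<le> (\<Sum>i\<le>k. hsemi k (vs i))"
          by (intro member_le_sum) (auto simp: hsemi_nonneg)
        then show ?thesis using hsemi_nonneg[of k v] by linarith
      next
        case False
        have "hsemi k (vs n - v) \<le> hsemi n (vs n - v)" using False by (intro hsemi_mono) auto
        moreover have "hsemi n (vs n - v) < 1 / real (Suc n)" using vs[of n] by (simp add: hball_def)
        moreover have "1 / real (Suc n) \<le> 1" by simp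
        moreover have "hsemi k (vs n) \<le> hsemi k (vs n - v) + hsemi k v"
          using hsemi_triangle[of k "vs n - v" v] by simp
        ultimately have "hsemi k (vs n) \<le> 1 + hsemi k v" by linarith
        moreover have "0 \<le> (\<Sum>i\<le>k. hsemi k (vs i))" by (intro sum_nonneg hsemi_nonneg)
        ultimately show ?thesis by linarith
      qed
      then show "bdd_above (hsemi k ` range vs)" by (auto intro!: bdd_aboveI)
    qed
    then obtain n where n: "\<And>u' i. u' \<in> hball n u \<Longrightarrow> norm (?D u' (vs i) - ?D u (vs i)) < e / 2"
      using C1_F_uniform[OF assms u, of "range vs" "e / 2"] e by auto
    have "?D u \<in> Lc" using assms u unfolding C1_F_def by auto
    then have "(?D u \<longlongrightarrow> ?D u v) (at v)"
      unfolding Lc_def continuous_on_def by auto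
    then have "(?D u \<longlongrightarrow> ?D u v) (nhds v)" by (simp add: tendsto_at_iff_tendsto_nhds)
    then have "\<forall>\<^sub>F v' in nhds v. dist (?D u v') (?D u v) < e / 2" using e by (intro tendstoD) auto
    then obtain m where m: "\<And>v'. v' \<in> hball m v \<Longrightarrow> dist (?D u v') (?D u v) < e / 2"
      unfolding eventually_nhds_history by auto
    define i where "i = max m n"
    have "dist (?D (us i) (vs i)) (?D u v) \<le> dist (?D (us i) (vs i)) (?D u (vs i)) + dist (?D u (vs i)) (?D u v)"
      by (rule dist_triangle)
    also have "\<dots> < e / 2 + e / 2"
    proof (rule add_strict_mono)
      show "dist (?D (us i) (vs i)) (?D u (vs i)) < e / 2"
        using n[of "us i" i] us[of i] hball_antimono[of n i u] unfolding i_def by (auto simp: dist_norm)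
      show "dist (?D u (vs i)) (?D u v) < e / 2"
        using m[of "vs i"] vs[of i] hball_antimono[of m i v] unfolding i_def by auto
    qed
    finally show False using far[of i] by simp
  qed
  then have "isCont (\<lambda>(u, v). ?D u v) p" if "p \<in> U \<times> UNIV" for p
    using that tendsto_at_iff_tendsto_nhds[of "\<lambda>(u, v). ?D u v" p]
    by (cases p) (simp add: isCont_def nhds_prod)
  then have "continuous_on (U \<times> UNIV) (\<lambda>(u, v). ?D u v)"
    by (intro continuous_at_imp_continuous_on ballI)
  then show ?thesis using assms unfolding C1_F_def C1_MB_def by auto
qed

lemma continuous_map_into_Lc_topologyI:
  fixes D :: "'b::real_normed_vector history \<Rightarrow> 'c::real_tvs \<Rightarrow> 'd::real_tvs"
  assumes Lc: "\<And>u. u \<in> O' \<Longrightarrow> D u \<in> Lc"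
    and cont: "\<And>u B N. u \<in> O' \<Longrightarrow> tvs_bounded B \<Longrightarrow> open N \<Longrightarrow> 0 \<in> N \<Longrightarrow>
      \<exists>n. \<forall>u'\<in>hball n u \<inter> O'. \<forall>v\<in>B. D u' v - D u v \<in> N"
  shows "continuous_map (top_of_set O') Lc_topology D"
  unfolding continuous_map_def topspace_Lc_topology
proof (intro conjI allI impI)
  show "D \<in> topspace (top_of_set O') \<rightarrow> Lc" using Lc by auto
  fix W :: "('c \<Rightarrow> 'd) set" assume W: "openin Lc_topology W"
  show "openin (top_of_set O') {u \<in> topspace (top_of_set O'). D u \<in> W}"
    unfolding openin_subopen[of _ "{u \<in> topspace (top_of_set O'). D u \<in> W}"]
  proof
    fix u assume u: "u \<in> {u \<in> topspace (top_of_set O'). D u \<in> W}"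
    obtain B N where BN: "tvs_bounded B" "open N" "0 \<in> N" "{A'\<in>Lc. \<forall>v\<in>B. A' v - D u v \<in> N} \<subseteq> W"
      using W u unfolding openin_Lc_topology by blast
    obtain n where n: "\<And>u' v. u' \<in> hball n u \<Longrightarrow> u' \<in> O' \<Longrightarrow> v \<in> B \<Longrightarrow> D u' v - D u v \<in> N"
      using cont[of u B N] u BN by auto
    have "openin (top_of_set O') (O' \<inter> hball n u)" by (simp add: open_hball openin_open_Int)
    moreover have "O' \<inter> hball n u \<subseteq> {u \<in> topspace (top_of_set O'). D u \<in> W}"
      using n Lc BN(4) by auto
    ultimately show "\<exists>T. openin (top_of_set O') T \<and> u \<in> T \<and> T \<subseteq> {u \<in> topspace (top_of_set O'). D u \<in> W}"
      using u center_in_hball by (intro exI[of _ "O' \<inter> hball n u"]) auto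
  qed
qed

text \<open>Only \<open>C1_MB\<close> is assumed, so both kinds of smoothness can interpret the
  locale; \<open>C1_F\<close> returns as a hypothesis of individual lemmas.\<close>

locale mb_smooth =
  fixes f :: "'b::euclidean_space history \<Rightarrow> 'b" and U :: "'b history set"
  assumes smooth: "C1_MB U f"
begin

section \<open>Linearity and local bounds of the derivative\<close>

abbreviation "Df \<equiv> dir_deriv f"

lemma open_U: "open U" and continuous_on_f: "continuous_on U f"
  using smooth unfolding C1_MB_def by auto

lemma continuous_on_Df:
  assumes "continuous_on S a" "continuous_on S b" "\<And>p. p \<in> S \<Longrightarrow> a p \<in> U"
  shows "continuous_on S (\<lambda>p. Df (a p) (b p))"
proof -
  have "continuous_on (U \<times> UNIV) (\<lambda>(u, v). Df u v)" using smooth unfolding C1_MB_def by auto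
  from continuous_on_compose2[OF this continuous_on_Pair[OF assms(1,2)]] assms(3) show ?thesis by auto
qed

lemma Df_near:
  assumes "u \<in> U" "0 < e"
  shows "\<exists>n. \<forall>u'\<in>hball n u. \<forall>v'\<in>hball n v. u' \<in> U \<and> norm (Df u' v' - Df u v) < e"
proof -
  have "open (U \<times> (UNIV :: 'b history set))" by (simp add: open_Times open_U)
  moreover have "continuous_on (U \<times> UNIV) (\<lambda>(u, v). Df u v)"
    using smooth unfolding C1_MB_def by auto
  ultimately have "isCont (\<lambda>(u, v). Df u v) (u, v)"
    using assms(1) by (simp add: continuous_on_eq_continuous_at)
  then have "((\<lambda>(u, v). Df u v) \<longlongrightarrow> Df u v) (at (u, v))"
    by (simp add: isCont_def)
  then have "((\<lambda>(u, v). Df u v) \<longlongrightarrow> Df u v) (nhds u \<times>\<^sub>F nhds v)"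
    using tendsto_at_iff_tendsto_nhds[of "\<lambda>(u, v). Df u v" "(u, v)"] by (simp add: nhds_prod)
  from tendstoD[OF this assms(2)]
  obtain n where n: "\<forall>u'\<in>hball n u. \<forall>v'\<in>hball n v. norm (Df u' v' - Df u v) < e"
    unfolding eventually_nhds_history_pair by (auto simp: dist_norm)
  obtain m where m: "hball m u \<subseteq> U" using open_U assms(1) unfolding open_history_iff_hball by blast
  show ?thesis
    using n m hball_antimono[of n "max m n" u] hball_antimono[of n "max m n" v] hball_antimono[of m "max m n" u]
    by (intro exI[of _ "max m n"]) (auto simp: subset_iff)
qed

lemma line_derivative:
  assumes "u + s *\<^sub>R v \<in> U"
  shows "((\<lambda>t. f (u + t *\<^sub>R v)) has_vector_derivative Df (u + s *\<^sub>R v) v) (at s)"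
proof -
  have "dir_differentiable f (u + s *\<^sub>R v) v" using smooth assms unfolding C1_MB_def by auto
  from dir_deriv_tendsto[OF this] show ?thesis
    unfolding has_vector_derivative_at_iff_quotient by (simp add: algebra_simps)
qed

text \<open>The mean value inequality for
  \<open>f (u + \<theta> *\<^sub>R v) - \<theta> *\<^sub>R c\<close>. The free vector
  \<open>c\<close> covers two uses: \<open>c = 0\<close> gives Lipschitz bounds, and the derivative
  at a fixed point gives linearization errors.\<close>

lemma mean_value:
  assumes "\<And>\<theta>. 0 \<le> \<theta> \<Longrightarrow> \<theta> \<le> 1 \<Longrightarrow> u + \<theta> *\<^sub>R v \<in> U"
    and "\<And>\<theta>. 0 \<le> \<theta> \<Longrightarrow> \<theta> \<le> 1 \<Longrightarrow> norm (Df (u + \<theta> *\<^sub>R v) v - c) \<le> e"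
  shows "norm (f (u + v) - f u - c) \<le> e"
proof -
  have "norm ((f (u + 1 *\<^sub>R v) - 1 *\<^sub>R c) - (f (u + 0 *\<^sub>R v) - 0 *\<^sub>R c)) \<le> e * 1 - e * 0"
  proof (rule norm_diff_le_by_derivative[where d="\<lambda>\<theta>. f (u + \<theta> *\<^sub>R v) - \<theta> *\<^sub>R c" and g="\<lambda>\<theta>. e * \<theta>"])
    fix \<theta> :: real assume \<theta>: "\<theta> \<in> {0..1}"
    have "((\<lambda>\<theta>. \<theta> *\<^sub>R c) has_vector_derivative 1 *\<^sub>R c) (at \<theta>)"
      by (auto intro!: derivative_eq_intros)
    then show "((\<lambda>\<theta>. f (u + \<theta> *\<^sub>R v) - \<theta> *\<^sub>R c) has_vector_derivative (Df (u + \<theta> *\<^sub>R v) v - 1 *\<^sub>R c)) (at \<theta> within {0..1})"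
      using assms(1)[of \<theta>] \<theta>
      by (intro has_vector_derivative_at_within[OF has_vector_derivative_diff[OF line_derivative]]) auto
    show "((\<lambda>\<theta>. e * \<theta>) has_vector_derivative e) (at \<theta> within {0..1})"
      unfolding has_real_derivative_iff_has_vector_derivative[symmetric]
      by (auto intro!: derivative_eq_intros)
    show "norm (Df (u + \<theta> *\<^sub>R v) v - 1 *\<^sub>R c) \<le> e" using assms(2)[of \<theta>] \<theta> by simp
  qed simp
  then show ?thesis by (simp add: algebra_simps)
qed

lemma Df_scaleR:
  assumes "u \<in> U"
  shows "Df u (c *\<^sub>R v) = c *\<^sub>R Df u v"
proof -
  have 1: "((\<lambda>t. f (u + t *\<^sub>R (c *\<^sub>R v))) has_vector_derivative Df u (c *\<^sub>R v)) (at 0)"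
    using line_derivative[of u 0 "c *\<^sub>R v"] assms by simp
  have "((\<lambda>t. c * t) has_vector_derivative c) (at 0)"
    unfolding has_real_derivative_iff_has_vector_derivative[symmetric]
    by (auto intro!: derivative_eq_intros)
  moreover have "((\<lambda>t. f (u + t *\<^sub>R v)) has_vector_derivative Df u v) (at (c * 0))"
    using line_derivative[of u 0 v] assms by simp
  ultimately have "(((\<lambda>t. f (u + t *\<^sub>R v)) \<circ> (\<lambda>t. c * t)) has_vector_derivative c *\<^sub>R Df u v) (at 0)"
    by (rule vector_diff_chain_at)
  with 1 show ?thesis
    by (auto simp: o_def mult.commute intro: vector_derivative_unique_at)
qed

lemma Df_zero: "u \<in> U \<Longrightarrow> Df u 0 = 0"
  using Df_scaleR[of u 0 0] by simp

text \<open>Additivity is not part of \<open>C1_MB\<close>. The quotient along \<open>v + w\<close>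
  splits into a step along \<open>v\<close> from \<open>u\<close> and a step along \<open>w\<close>
  from the moving point \<open>u + t *\<^sub>R v\<close>. The latter tends to \<open>Df u w\<close>,
  as \<open>Df\<close> is continuous in the base point.\<close>

lemma Df_add:
  assumes "u \<in> U"
  shows "Df u (v + w) = Df u v + Df u w"
proof -
  have "((\<lambda>t. (1 / t) *\<^sub>R (f ((u + t *\<^sub>R v) + t *\<^sub>R w) - f (u + t *\<^sub>R v))) \<longlongrightarrow> Df u w) (at 0)"
  proof (rule tendstoI)
    fix e :: real assume e: "0 < e"
    then obtain n where n: "\<And>u'. u' \<in> hball n u \<Longrightarrow> u' \<in> U \<and> norm (Df u' w - Df u w) < e / 2"
      using Df_near[OF assms, of "e / 2" w] center_in_hball by (metis half_gt_zero)
    \<comment> \<open>If \<open>\<bar>t\<bar> * M\<close> is below the radius, the whole second step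
      stays in the ball. The summand \<open>1\<close> makes \<open>M\<close> positive.\<close>
    define M where "M = hsemi n v + hsemi n w + 1"
    have M: "0 < M" unfolding M_def using hsemi_nonneg[of n v] hsemi_nonneg[of n w] by linarith
    have "\<forall>\<^sub>F t in at 0. t \<noteq> 0 \<and> \<bar>t\<bar> * M < 1 / real (Suc n)"
      unfolding eventually_at using M
      by (intro exI[of _ "1 / real (Suc n) / M"]) (auto simp: pos_less_divide_eq mult_ac)
    then show "\<forall>\<^sub>F t in at 0. dist ((1 / t) *\<^sub>R (f ((u + t *\<^sub>R v) + t *\<^sub>R w) - f (u + t *\<^sub>R v))) (Df u w) < e"
    proof eventually_elim
      case (elim t)
      have near: "u + t *\<^sub>R v + \<theta> *\<^sub>R t *\<^sub>R w \<in> hball n u" if "0 \<le> \<theta>" "\<theta> \<le> 1" for \<theta>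
      proof -
        have "hsemi n ((u + t *\<^sub>R v + \<theta> *\<^sub>R t *\<^sub>R w) - u) \<le> hsemi n (t *\<^sub>R v) + hsemi n ((\<theta> * t) *\<^sub>R w)"
          using hsemi_triangle[of n "t *\<^sub>R v" "(\<theta> * t) *\<^sub>R w"] by (simp add: algebra_simps)
        also have "\<dots> = \<bar>t\<bar> * hsemi n v + \<theta> * (\<bar>t\<bar> * hsemi n w)"
          unfolding hsemi_scaleR using that by (simp add: abs_mult)
        also have "\<dots> \<le> \<bar>t\<bar> * hsemi n v + 1 * (\<bar>t\<bar> * hsemi n w)"
          using that by (intro add_left_mono mult_right_mono) (auto simp: hsemi_nonneg)
        also have "\<dots> \<le> \<bar>t\<bar> * M" unfolding M_def by (simp add: algebra_simps)
        finally show ?thesis using elim by (simp add: hball_def)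
      qed
      have "norm (f (u + t *\<^sub>R v + t *\<^sub>R w) - f (u + t *\<^sub>R v) - t *\<^sub>R Df u w) \<le> \<bar>t\<bar> * (e / 2)"
      proof (rule mean_value)
        fix \<theta> :: real assume "0 \<le> \<theta>" "\<theta> \<le> 1"
        note nn = n[OF near[OF this]]
        then show "u + t *\<^sub>R v + \<theta> *\<^sub>R t *\<^sub>R w \<in> U" by simp
        have "\<bar>t\<bar> * norm (Df (u + t *\<^sub>R v + \<theta> *\<^sub>R t *\<^sub>R w) w - Df u w) \<le> \<bar>t\<bar> * (e / 2)"
          using nn by (intro mult_left_mono) auto
        then show "norm (Df (u + t *\<^sub>R v + \<theta> *\<^sub>R t *\<^sub>R w) (t *\<^sub>R w) - t *\<^sub>R Df u w) \<le> \<bar>t\<bar> * (e / 2)"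
          unfolding Df_scaleR[OF conjunct1[OF nn]] scaleR_diff_right[symmetric] norm_scaleR .
      qed
      moreover have "(1 / t) *\<^sub>R (f (u + t *\<^sub>R v + t *\<^sub>R w) - f (u + t *\<^sub>R v)) - Df u w =
          (1 / t) *\<^sub>R (f (u + t *\<^sub>R v + t *\<^sub>R w) - f (u + t *\<^sub>R v) - t *\<^sub>R Df u w)"
        using elim by (simp add: algebra_simps)
      ultimately have "dist ((1 / t) *\<^sub>R (f (u + t *\<^sub>R v + t *\<^sub>R w) - f (u + t *\<^sub>R v))) (Df u w) \<le> e / 2"
        using elim unfolding dist_norm by (simp add: divide_simps mult.commute)
      then show ?case using e by simp
    qed
  qed
  moreover have "((\<lambda>t. (1 / t) *\<^sub>R (f (u + t *\<^sub>R v) - f u)) \<longlongrightarrow> Df u v) (at 0)"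
    using smooth assms unfolding C1_MB_def by (intro dir_deriv_tendsto) auto
  ultimately have "((\<lambda>t. (1 / t) *\<^sub>R (f (u + t *\<^sub>R v) - f u) +
      (1 / t) *\<^sub>R (f ((u + t *\<^sub>R v) + t *\<^sub>R w) - f (u + t *\<^sub>R v))) \<longlongrightarrow> Df u v + Df u w) (at 0)"
    by (intro tendsto_add)
  then show ?thesis
    by (intro dir_derivI) (simp add: algebra_simps)
qed

lemma Df_diff: "u \<in> U \<Longrightarrow> Df u (v - w) = Df u v - Df u w"
  using Df_add[of u "v - w" w] by simp

text \<open>Joint continuity at \<open>(\<phi>, 0)\<close> bounds \<open>Df \<psi> v\<close> by
  \<open>1\<close> for \<open>\<psi>\<close> and \<open>v\<close> in balls of one index
  \<open>n\<close>. Homogeneity turns this into a linear bound, whose constant \<open>n + 1\<close>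
  is the inverse of the radius.\<close>

lemma local_bound:
  assumes "\<phi> \<in> U"
  shows "\<exists>n. \<forall>\<psi>\<in>hball n \<phi>. \<psi> \<in> U \<and> (\<forall>v. norm (Df \<psi> v) \<le> real (Suc n) * hsemi n v)"
proof -
  obtain n where n: "\<And>\<psi> v. \<psi> \<in> hball n \<phi> \<Longrightarrow> v \<in> hball n 0 \<Longrightarrow> \<psi> \<in> U \<and> norm (Df \<psi> v) < 1"
    using Df_near[OF assms, of 1 0] assms by (auto simp: Df_zero)
  have "norm (Df \<psi> v) \<le> real (Suc n) * hsemi n v" if \<psi>: "\<psi> \<in> hball n \<phi>" for \<psi> v
  proof (rule field_le_epsilon)
    fix e :: real assume e: "0 < e"
    \<comment> \<open>The seminorm can vanish for nonzero \<open>v\<close>; adding \<open>e\<close>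
      keeps the divisor positive.\<close>
    define c where "c = real (Suc n) * hsemi n v + e"
    have c: "0 < c" unfolding c_def using e hsemi_nonneg[of n v] by (intro add_nonneg_pos) auto
    have "v /\<^sub>R c \<in> hball n 0" using c e
      by (simp add: hball_def hsemi_scaleR divide_simps) (simp add: c_def algebra_simps)
    from n[OF \<psi> this] have "\<psi> \<in> U" "norm (Df \<psi> (v /\<^sub>R c)) < 1" by auto
    then have "norm (Df \<psi> v) / c < 1" using c by (simp add: Df_scaleR divide_inverse_commute)
    then show "norm (Df \<psi> v) \<le> real (Suc n) * hsemi n v + e"
      using c unfolding c_def[symmetric] by (simp add: pos_divide_less_eq)
  qed
  then show ?thesis using n center_in_hball by (intro exI[of _ n]) blast
qed

end

section \<open>Solutions close to a given solution\<close>

lemma is_solution_Icc_iff: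
  fixes f :: "'b::real_normed_vector history \<Rightarrow> 'b"
  assumes "0 \<le> T"
  shows "is_solution f U {0..T} x \<longleftrightarrow> continuous_on {..T} x \<and>
    (\<forall>t\<in>{0..T}. segment x t \<in> U \<and> (x has_vector_derivative f (segment x t)) (at t within {0..T}))"
proof -
  have "{..0} + {0..T} = {..T}"
  proof
    show "{..T} \<subseteq> {..0} + {0..T}"
    proof
      fix t assume "t \<in> {..T}"
      then have "(t - T) + T \<in> {..0} + {0..T}" using assms by (intro set_plus_intro) auto
      then show "t \<in> {..0} + {0..T}" by simp
    qed
  qed (auto elim!: set_plus_elim)
  then show ?thesis unfolding is_solution_def by (simp add: is_interval_cc)
qed

lemma is_solution_subset:
  assumes "is_solution f U I x" "J \<subseteq> I" "is_interval J"
  shows "is_solution f U J x"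
  using assms set_plus_mono2[of "{..0}" "{..0}" J I] unfolding is_solution_def
  by (blast intro: continuous_on_subset has_vector_derivative_within_subset)

text \<open>For times before \<open>0\<close> the difference is that of the initial histories. Hence
  a bound on \<open>{0..t}\<close>, which Gronwall gives in terms of one index, carries over to
  every seminorm.\<close>

lemma hsemi_segment_diff_le_add:
  assumes "continuous_on {..t} y" "continuous_on {..t} z" "0 \<le> t" "0 \<le> c"
    and "\<And>s. s \<in> {0..t} \<Longrightarrow> norm (y s - z s) \<le> c"
  shows "hsemi k (segment y t - segment z t) \<le> hsemi k (segment y 0 - segment z 0) + c"
proof (rule hsemi_segment_diff_le[OF assms(1,2)])
  fix r assume r: "t - real k \<le> r" "r \<le> t"
  show "norm (y r - z r) \<le> hsemi k (segment y 0 - segment z 0) + c"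
  proof (cases "0 \<le> r")
    case True
    then show ?thesis using assms(5)[of r] r hsemi_nonneg[of k "segment y 0 - segment z 0"] by simp
  next
    case False
    have "norm (y r - z r) \<le> hsemi k (segment y 0 - segment z 0)"
      using r False assms(3) continuous_on_subset[OF assms(1)] continuous_on_subset[OF assms(2)]
      by (intro norm_le_hsemi_segment_diff) auto
    then show ?thesis using assms(4) by simp
  qed
qed

context mb_smooth
begin

text \<open>Radius, seminorm and Lipschitz constant share the single index \<open>n\<close>, which makes the condition at
  each \<open>s\<close> monotone in \<open>n\<close>, so that \<open>uniform_index\<close> applies.\<close>

definition tube :: "nat \<Rightarrow> (real \<Rightarrow> 'b) \<Rightarrow> real \<Rightarrow> bool" where
  "tube n x T \<longleftrightarrow> (\<forall>s\<in>{0..T}. \<forall>\<psi>\<in>hball n (segment x s).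
     \<psi> \<in> U \<and> (\<forall>v. norm (Df \<psi> v) \<le> real (Suc n) * hsemi n v))"

lemma tube_mono:
  assumes "tube n x T" "t \<le> T"
  shows "tube n x t"
proof -
  have "{0..t} \<subseteq> {0..T}" using assms(2) by auto
  then show ?thesis using assms(1) unfolding tube_def by blast
qed

lemma ex_tube:
  assumes "continuous_on {..T} x" "\<And>s. s \<in> {0..T} \<Longrightarrow> segment x s \<in> U"
  shows "\<exists>n. tube n x T"
  unfolding tube_def
proof (rule uniform_index)
  fix s m n assume mn: "m \<le> n" and
    *: "\<forall>\<psi>\<in>hball m (segment x s). \<psi> \<in> U \<and> (\<forall>v. norm (Df \<psi> v) \<le> real (Suc m) * hsemi m v)"
  show "\<forall>\<psi>\<in>hball n (segment x s). \<psi> \<in> U \<and> (\<forall>v. norm (Df \<psi> v) \<le> real (Suc n) * hsemi n v)"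
  proof
    fix \<psi> assume "\<psi> \<in> hball n (segment x s)"
    then have \<psi>: "\<psi> \<in> hball m (segment x s)" using hball_antimono[OF mn] by blast
    have "real (Suc m) * hsemi m v \<le> real (Suc n) * hsemi n v" for v :: "'b history"
      using mn by (intro mult_mono hsemi_mono) (auto simp: hsemi_nonneg)
    then show "\<psi> \<in> U \<and> (\<forall>v. norm (Df \<psi> v) \<le> real (Suc n) * hsemi n v)"
      using * \<psi> by (meson order_trans)
  qed
next
  fix s assume s: "s \<in> {0..T}"
  obtain m where m: "\<And>\<psi>. \<psi> \<in> hball m (segment x s) \<Longrightarrow>
      \<psi> \<in> U \<and> (\<forall>v. norm (Df \<psi> v) \<le> real (Suc m) * hsemi m v)"
    using local_bound[OF assms(2)[OF s]] by blast
  \<comment> \<open>Half the radius lets the centre move from \<open>segment x s\<close> to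
    \<open>segment x r\<close> while the new ball stays in the old one.\<close>
  define n where "n = 2 * m + 1"
  obtain d where "0 < d" and
    d: "\<And>r. r \<in> {0..T} \<Longrightarrow> \<bar>r - s\<bar> < d \<Longrightarrow> segment x r \<in> hball n (segment x s)"
    using segment_near[OF assms(1) s] by blast
  have "\<psi> \<in> U \<and> (\<forall>v. norm (Df \<psi> v) \<le> real (Suc n) * hsemi n v)"
    if "r \<in> {0..T}" "\<bar>r - s\<bar> < d" "\<psi> \<in> hball n (segment x r)" for r \<psi>
  proof -
    have "\<psi> \<in> hball m (segment x s)"
      using hball_half_subset[of "segment x r" m "segment x s"] d[OF that(1,2)] that(3)
      unfolding n_def by blast
    moreover have "real (Suc m) * hsemi m v \<le> real (Suc n) * hsemi n v" for v :: "'b history"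
      unfolding n_def by (intro mult_mono hsemi_mono) (auto simp: hsemi_nonneg)
    ultimately show ?thesis using m by (meson order_trans)
  qed
  then show "\<exists>n. \<exists>d>0. \<forall>r\<in>{0..T}. \<bar>r - s\<bar> < d \<longrightarrow> (\<forall>\<psi>\<in>hball n (segment x r).
      \<psi> \<in> U \<and> (\<forall>v. norm (Df \<psi> v) \<le> real (Suc n) * hsemi n v))"
    using \<open>0 < d\<close> by blast
qed

text \<open>The line between two points of a ball stays in it, so the derivative bound of the tube
  integrates to a Lipschitz bound.\<close>

lemma tube_lipschitz:
  assumes "tube n x T" "s \<in> {0..T}" "\<psi> \<in> hball n (segment x s)" "\<psi>' \<in> hball n (segment x s)"
  shows "norm (f \<psi> - f \<psi>') \<le> real (Suc n) * hsemi n (\<psi> - \<psi>')"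
proof -
  have near: "\<psi>' + \<theta> *\<^sub>R (\<psi> - \<psi>') \<in> hball n (segment x s)" if "0 \<le> \<theta>" "\<theta> \<le> 1" for \<theta>
  proof -
    have "\<psi>' + \<theta> *\<^sub>R (\<psi> - \<psi>') - segment x s =
        (1 - \<theta>) *\<^sub>R (\<psi>' - segment x s) + \<theta> *\<^sub>R (\<psi> - segment x s)"
      by (simp add: algebra_simps)
    then show ?thesis
      using hsemi_convex_comb[OF that, of n "\<psi>' - segment x s" "1 / real (Suc n)" "\<psi> - segment x s"] assms(3,4)
      unfolding hball_def by simp
  qed
  have "norm (f (\<psi>' + (\<psi> - \<psi>')) - f \<psi>' - 0) \<le> real (Suc n) * hsemi n (\<psi> - \<psi>')"
    using near assms(1,2) unfolding tube_def by (intro mean_value) auto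
  then show ?thesis by simp
qed

text \<open>In the tube the difference of two solutions satisfies the hypothesis of
  \<open>delay_gronwall\<close> with error \<open>e = 0\<close>.\<close>

lemma solutions_close:
  assumes T: "0 \<le> T" and tube: "tube n x T"
    and y: "is_solution f U {0..T} y" "\<And>s. s \<in> {0..T} \<Longrightarrow> segment y s \<in> hball n (segment x s)"
    and z: "is_solution f U {0..T} z" "\<And>s. s \<in> {0..T} \<Longrightarrow> segment z s \<in> hball n (segment x s)"
    and t: "t \<in> {0..T}"
  shows "norm (y t - z t) \<le> growth (real (Suc n)) T * hsemi n (segment y 0 - segment z 0)"
proof -
  note y' = y(1)[unfolded is_solution_Icc_iff[OF T]] and z' = z(1)[unfolded is_solution_Icc_iff[OF T]]
  have cont: "continuous_on {..s} y" "continuous_on {..s} z" if "s \<le> T" for s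
    using y' z' that by (auto intro: continuous_on_subset)
  have "norm (y t - z t) \<le> growth (real (Suc n)) T * (hsemi n (segment y 0 - segment z 0) + 0)"
  proof (rule delay_gronwall[where d="\<lambda>t. y t - z t" and d'="\<lambda>t. f (segment y t) - f (segment z t)" and n=n])
    show "continuous_on {..T} (\<lambda>t. y t - z t)" by (intro continuous_intros cont) auto
    show "norm (y t - z t) \<le> hsemi n (segment y 0 - segment z 0)" if "- real n \<le> t" "t \<le> 0" for t
      using that T by (intro norm_le_hsemi_segment_diff cont) auto
    fix s assume s: "s \<in> {0..T}"
    show "((\<lambda>t. y t - z t) has_vector_derivative f (segment y s) - f (segment z s)) (at s within {0..T})"
      using y' z' s by (intro has_vector_derivative_diff) auto
    show "norm (f (segment y s) - f (segment z s)) \<le> real (Suc n) * hsemi n (segment (\<lambda>t. y t - z t) s) + 0"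
      using tube_lipschitz[OF tube s y(2)[OF s] z(2)[OF s]] s by (simp add: segment_diff cont)
  qed (use t in auto)
  then show ?thesis by simp
qed

text \<open>Up to the first time \<open>\<tau>\<close> at which \<open>y\<close> has distance \<open>1 / (2 * (n + 1))\<close> from \<open>x\<close>, both
  solutions are in the tube; but then \<open>solutions_close\<close> gives a smaller distance at \<open>\<tau>\<close>.\<close>

lemma solution_stays_close:
  assumes T: "0 \<le> T" and tube: "tube n x T"
    and x: "is_solution f U {0..T} x" and y: "is_solution f U {0..T} y"
    and small: "growth (real (Suc n)) T * hsemi n (segment y 0 - segment x 0) < 1 / real (Suc (2 * n + 1))"
    and t: "t \<in> {0..T}"
  shows "segment y t \<in> hball n (segment x t)"
proof -
  define \<epsilon> where "\<epsilon> = 1 / real (Suc (2 * n + 1))"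
  have \<epsilon>: "0 < \<epsilon>" "\<epsilon> < 1 / real (Suc n)" unfolding \<epsilon>_def by (auto simp: field_simps)
  define a where "a = hsemi n (segment y 0 - segment x 0)"
  have a0: "0 \<le> a" unfolding a_def by (rule hsemi_nonneg)
  \<comment> \<open>The growth constant is at least \<open>1\<close>, so the smallness condition
    also puts the initial distance below \<open>\<epsilon>\<close>, as the intermediate value
    argument requires.\<close>
  have "1 * a \<le> growth (real (Suc n)) T * a" using a0 T by (intro mult_right_mono growth_ge_1) auto
  then have a: "a < \<epsilon>" using small unfolding a_def \<epsilon>_def by simp
  note x' = x[unfolded is_solution_Icc_iff[OF T]] and y' = y[unfolded is_solution_Icc_iff[OF T]]
  have cont: "continuous_on {..s} x" "continuous_on {..s} y" if "s \<le> T" for s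
    using y' x' that by (auto intro: continuous_on_subset)
  have past: "norm (y r - x r) \<le> a" if "- real n \<le> r" "r \<le> 0" for r
    unfolding a_def using that T by (intro norm_le_hsemi_segment_diff cont) auto
  have in_tube: "segment y s \<in> hball n (segment x s)"
    if s: "s \<in> {0..T}" and le: "\<And>r. r \<in> {0..s} \<Longrightarrow> norm (y r - x r) \<le> \<epsilon>" for s
  proof -
    have "hsemi n (segment y s - segment x s) \<le> \<epsilon>"
    proof (rule hsemi_segment_diff_le)
      fix r assume "s - real n \<le> r" "r \<le> s"
      then show "norm (y r - x r) \<le> \<epsilon>"
        using le[of r] past[of r] a s by (cases "0 \<le> r") auto
    qed (use s cont in auto)
    then show ?thesis using \<epsilon> unfolding hball_def by simp
  qed
  have "norm (y s - x s) < \<epsilon>" if s: "s \<in> {0..T}" for s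
  proof (rule ccontr)
    assume "\<not> norm (y s - x s) < \<epsilon>"
    have hit: "\<exists>r\<in>{0..s}. norm (y r - x r) = \<epsilon>" if "s \<in> {0..T}" "\<epsilon> \<le> norm (y s - x s)" for s
    proof -
      have "continuous_on {0..s} (\<lambda>r. norm (y r - x r))"
        using that by (intro continuous_intros continuous_on_subset[OF cont(1)[of T]] continuous_on_subset[OF cont(2)[of T]]) auto
      then show ?thesis
        using IVT'[of "\<lambda>r. norm (y r - x r)" 0 \<epsilon> s] past[of 0] a that by auto
    qed
    define K where "K = {s \<in> {0..T}. norm (y s - x s) = \<epsilon>}"
    have "continuous_on {0..T} (\<lambda>r. norm (y r - x r))"
      by (intro continuous_intros continuous_on_subset[OF cont(1)[of T]] continuous_on_subset[OF cont(2)[of T]]) auto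
    then have "closed K"
      unfolding K_def using continuous_closed_preimage_constant[of "{0..T}" "\<lambda>r. norm (y r - x r)" \<epsilon>] by simp
    moreover have "bounded K" by (rule bounded_subset[of "{0..T}"]) (auto simp: K_def)
    ultimately have "compact K" by (simp add: compact_eq_bounded_closed)
    obtain r where "r \<in> {0..s}" "norm (y r - x r) = \<epsilon>"
      using hit[OF s] \<open>\<not> norm (y s - x s) < \<epsilon>\<close> by auto
    then have "r \<in> K" using s unfolding K_def by auto
    then have "K \<noteq> {}" by blast
    then obtain \<tau> where \<tau>: "\<tau> \<in> K" "\<And>s. s \<in> K \<Longrightarrow> \<tau> \<le> s"
      using compact_attains_inf[OF \<open>compact K\<close>] by blast
    then have \<tau>T: "\<tau> \<in> {0..T}" "norm (y \<tau> - x \<tau>) = \<epsilon>" unfolding K_def by auto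
    have before: "norm (y s - x s) \<le> \<epsilon>" if s: "s \<in> {0..\<tau>}" for s
    proof (rule ccontr)
      assume "\<not> norm (y s - x s) \<le> \<epsilon>"
      then obtain r where "r \<in> {0..s}" "norm (y r - x r) = \<epsilon>" using hit[of s] s \<tau>T by auto
      then have "\<tau> \<le> r" using \<tau>(2)[of r] s \<tau>T unfolding K_def by auto
      then have "s = \<tau>" using \<open>r \<in> {0..s}\<close> s by auto
      then show False using \<tau>T \<open>\<not> norm (y s - x s) \<le> \<epsilon>\<close> by auto
    qed
    have "norm (y \<tau> - x \<tau>) \<le> growth (real (Suc n)) \<tau> * a"
      unfolding a_def
    proof (rule solutions_close)
      show "tube n x \<tau>" using tube_mono[OF tube] \<tau>T by auto
      show "is_solution f U {0..\<tau>} y" "is_solution f U {0..\<tau>} x"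
        by (rule is_solution_subset[OF y] is_solution_subset[OF x]; use \<tau>T in \<open>auto simp: is_interval_cc\<close>)+
      show "segment y s \<in> hball n (segment x s)" if "s \<in> {0..\<tau>}" for s
        using that \<tau>T before by (intro in_tube) auto
    qed (use \<tau>T in \<open>auto intro: center_in_hball\<close>)
    also have "\<dots> \<le> growth (real (Suc n)) T * a" using a0 \<tau>T by (intro mult_right_mono growth_mono) auto
    also have "\<dots> < \<epsilon>" using small unfolding a_def \<epsilon>_def .
    finally show False using \<tau>T by simp
  qed
  then show ?thesis using t by (intro in_tube) (auto intro: less_imp_le)
qed

text \<open>With equal histories the initial distance is \<open>0\<close>. Hence \<open>y\<close>
  stays in a tube around \<open>x\<close>, where \<open>solutions_close\<close> gives distance
  \<open>0\<close>; negative times are read off from the common initial segment.\<close>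

lemma solution_unique:
  assumes T: "0 \<le> T" and x: "is_solution f U {0..T} x" and y: "is_solution f U {0..T} y"
    and init: "segment x 0 = segment y 0" and t: "t \<le> T"
  shows "x t = y t"
proof -
  note x' = x[unfolded is_solution_Icc_iff[OF T]] and y' = y[unfolded is_solution_Icc_iff[OF T]]
  show ?thesis
  proof (cases "0 \<le> t")
    case True
    obtain n where n: "tube n x T" using ex_tube x' by blast
    have "norm (y t - x t) \<le> growth (real (Suc n)) T * hsemi n (segment y 0 - segment x 0)"
    proof (rule solutions_close[OF T n y _ x])
      show "segment y s \<in> hball n (segment x s)" if "s \<in> {0..T}" for s
        by (rule solution_stays_close[OF T n x y _ that]) (simp add: init hsemi_zero)
    qed (use True t in \<open>auto intro: center_in_hball\<close>)
    then show ?thesis by (simp add: init hsemi_zero)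
  next
    case False
    have "continuous_on {..0} x" "continuous_on {..0} y"
      using x' y' T by (auto intro: continuous_on_subset)
    then show ?thesis using happly_segment[of 0 x t] happly_segment[of 0 y t] init False by simp
  qed
qed

text \<open>Retracting the difference to \<open>x\<close> onto a small ball turns \<open>f\<close> into a right-hand side that is
  globally defined and Lipschitz along \<open>x\<close>; its solutions never leave the region where nothing was
  changed.\<close>

lemma solution_exists_near:
  assumes T: "0 \<le> T" and tube: "tube n x T" and x: "is_solution f U {0..T} x"
    and small: "growth (real (Suc n)) T * hsemi n (\<phi> - segment x 0) < 1 / real (Suc (2 * n + 1))"
  shows "\<exists>y. is_solution f U {0..T} y \<and> segment y 0 = \<phi>"
proof -
  define \<epsilon> where "\<epsilon> = 1 / real (Suc (2 * n + 1))"
  have \<epsilon>: "0 < \<epsilon>" "\<epsilon> < 1 / real (Suc n)" unfolding \<epsilon>_def by (auto simp: field_simps)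
  note x' = x[unfolded is_solution_Icc_iff[OF T]]
  have cont_x: "continuous_on {..s} x" if "s \<le> T" for s
    using x' that by (auto intro: continuous_on_subset)
  let ?\<rho> = "closest_point (cball (0::'b) \<epsilon>)"
  have B: "convex (cball (0::'b) \<epsilon>)" "closed (cball (0::'b) \<epsilon>)" "cball (0::'b) \<epsilon> \<noteq> {}" using \<epsilon> by auto
  have \<rho>_le: "norm (?\<rho> z) \<le> \<epsilon>" for z using closest_point_in_set[OF B(2,3)] by simp
  have \<rho>_lip: "norm (?\<rho> z - ?\<rho> z') \<le> norm (z - z')" for z z'
    using closest_point_lipschitz[OF B] by (simp add: dist_norm)
  have \<rho>_id: "norm z \<le> \<epsilon> \<Longrightarrow> ?\<rho> z = z" for z by (intro closest_point_self) auto
  \<comment> \<open>The retraction acts pointwise in time, so \<open>P y\<close> stays within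
    \<open>\<epsilon>\<close> of \<open>x\<close> whatever \<open>y\<close> is, and \<open>f\<close>
    is evaluated only inside the tube.\<close>
  define P where "P y r = x r + ?\<rho> (y r - x r)" for y r
  have cont_P: "continuous_on {..s} (P y)" if "continuous_on {..s} y" "s \<le> T"
    for y :: "real \<Rightarrow> 'b" and s
    unfolding P_def
    by (intro continuous_intros continuous_on_compose2[OF continuous_on_closest_point[OF B]] cont_x that) auto
  have P_near: "segment (P y) s \<in> hball n (segment x s)" if "continuous_on {..s} y" "s \<le> T"
    for y :: "real \<Rightarrow> 'b" and s
  proof -
    have "hsemi n (segment (P y) s - segment x s) \<le> \<epsilon>"
      by (intro hsemi_segment_diff_le cont_P cont_x that) (auto simp: P_def \<rho>_le)
    then show ?thesis using \<epsilon> by (simp add: hball_def)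
  qed
  obtain y where y: "continuous_on UNIV y" "segment y 0 = \<phi>"
    and der: "\<And>t. t \<in> {0..T} \<Longrightarrow> (y has_vector_derivative f (segment (P y) t)) (at t within {0..T})"
  proof (rule picard_existence[where \<Phi>="\<lambda>y s. f (segment (P y) s)" and T=T and L="real (Suc n)" and \<phi>=\<phi>])
    fix y :: "real \<Rightarrow> 'b" assume y: "continuous_on UNIV y"
    have "continuous_on {0..T} (segment (P y))"
      by (rule continuous_on_subset[OF continuous_on_segment[OF cont_P[OF continuous_on_subset[OF y]]]]) auto
    then show "continuous_on {0..T} (\<lambda>s. f (segment (P y) s))"
    proof (rule continuous_on_compose2[OF continuous_on_f])
      show "segment (P y) ` {0..T} \<subseteq> U"
        using P_near[OF continuous_on_subset[OF y]] tube unfolding tube_def by auto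
    qed
  next
    fix y y' :: "real \<Rightarrow> 'b" and s B assume *: "continuous_on UNIV y" "continuous_on UNIV y'" "s \<in> {0..T}"
      "\<And>r. r \<le> s \<Longrightarrow> norm (y r - y' r) \<le> B"
    have yy: "continuous_on {..s} y" "continuous_on {..s} y'" using *(1,2) by (auto intro: continuous_on_subset)
    have "hsemi n (segment (P y) s - segment (P y') s) \<le> B"
    proof (intro hsemi_segment_diff_le cont_P yy)
      fix r assume "r \<le> s"
      then show "norm (P y r - P y' r) \<le> B"
        using \<rho>_lip[of "y r - x r" "y' r - x r"] *(4)[of r] by (simp add: P_def)
    qed (use * in auto)
    then have "real (Suc n) * hsemi n (segment (P y) s - segment (P y') s) \<le> real (Suc n) * B"
      by (intro mult_left_mono) auto
    moreover have "norm (f (segment (P y) s) - f (segment (P y') s)) \<le>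
        real (Suc n) * hsemi n (segment (P y) s - segment (P y') s)"
      using *(3) by (intro tube_lipschitz[OF tube *(3)] P_near yy) auto
    ultimately show "norm (f (segment (P y) s) - f (segment (P y') s)) \<le> real (Suc n) * B"
      by linarith
  qed (use T in auto)
  have cont_y: "continuous_on {..s} y" for s using y(1) by (rule continuous_on_subset) auto
  have near: "norm (y t - x t) \<le> \<epsilon>" if t: "t \<in> {0..T}" for t
  proof -
    have "norm (y t - x t) \<le> growth (real (Suc n)) T * (hsemi n (\<phi> - segment x 0) + 0)"
    proof (rule delay_gronwall[where d="\<lambda>t. y t - x t" and d'="\<lambda>t. f (segment (P y) t) - f (segment x t)" and n=n])
      show "continuous_on {..T} (\<lambda>t. y t - x t)" by (intro continuous_intros cont_x cont_y) auto
      show "norm (y t - x t) \<le> hsemi n (\<phi> - segment x 0)" if "- real n \<le> t" "t \<le> 0" for t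
        unfolding y(2)[symmetric] using that T by (intro norm_le_hsemi_segment_diff cont_x cont_y) auto
      fix s assume s: "s \<in> {0..T}"
      show "((\<lambda>t. y t - x t) has_vector_derivative f (segment (P y) s) - f (segment x s)) (at s within {0..T})"
        using x' s der by (intro has_vector_derivative_diff) auto
      \<comment> \<open>The retraction is nonexpansive and fixes \<open>0\<close>. This makes the
        Gronwall estimate available before \<open>y\<close> is known to be close to
        \<open>x\<close>.\<close>
      have "hsemi n (segment (P y) s - segment x s) \<le> hsemi n (segment y s - segment x s)"
      proof (rule hsemi_segment_diff_le)
        fix r assume r: "s - real n \<le> r" "r \<le> s"
        have "norm (P y r - x r) \<le> norm (y r - x r)"
          using \<rho>_lip[of "y r - x r" 0] \<rho>_id[of 0] \<epsilon> by (simp add: P_def)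
        also have "\<dots> \<le> hsemi n (segment y s - segment x s)"
          using r s by (intro norm_le_hsemi_segment_diff cont_x cont_y) auto
        finally show "norm (P y r - x r) \<le> hsemi n (segment y s - segment x s)" .
      qed (use s in \<open>auto intro!: cont_P cont_x cont_y\<close>)
      then have "real (Suc n) * hsemi n (segment (P y) s - segment x s) \<le>
          real (Suc n) * hsemi n (segment y s - segment x s)" by (intro mult_left_mono) auto
      moreover have "norm (f (segment (P y) s) - f (segment x s)) \<le>
          real (Suc n) * hsemi n (segment (P y) s - segment x s)"
        using s by (intro tube_lipschitz[OF tube s] P_near cont_y center_in_hball) auto
      ultimately have "norm (f (segment (P y) s) - f (segment x s)) \<le>
          real (Suc n) * hsemi n (segment y s - segment x s)" by linarith
      then show "norm (f (segment (P y) s) - f (segment x s)) \<le>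
          real (Suc n) * hsemi n (segment (\<lambda>t. y t - x t) s) + 0"
        using s by (simp add: segment_diff cont_x cont_y)
    qed (use t in auto)
    then show ?thesis using small unfolding \<epsilon>_def by simp
  qed
  have "growth (real (Suc n)) T * hsemi n (\<phi> - segment x 0) \<ge> 1 * hsemi n (\<phi> - segment x 0)"
    using T by (intro mult_right_mono growth_ge_1 hsemi_nonneg) auto
  then have past: "hsemi n (\<phi> - segment x 0) \<le> \<epsilon>" using small unfolding \<epsilon>_def by linarith
  have near': "norm (y r - x r) \<le> \<epsilon>" if "- real n \<le> r" "r \<le> T" for r
  proof (cases "0 \<le> r")
    case False
    have "norm (y r - x r) \<le> hsemi n (segment y 0 - segment x 0)"
      using that False T by (intro norm_le_hsemi_segment_diff cont_x cont_y) auto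
    then show ?thesis using past y(2) by simp
  qed (use near that in auto)
  have "segment y t \<in> U \<and> f (segment (P y) t) = f (segment y t)" if t: "t \<in> {0..T}" for t
  proof
    have "hsemi n (segment y t - segment x t) \<le> \<epsilon>"
      using t by (intro hsemi_segment_diff_le cont_x cont_y near') auto
    then have yt: "segment y t \<in> hball n (segment x t)" using \<epsilon> by (simp add: hball_def)
    then show "segment y t \<in> U" using tube t unfolding tube_def by auto
    \<comment> \<open>Before time \<open>- n\<close> the history \<open>\<phi>\<close> may be far
      from \<open>x\<close>, so the two segments need not be equal. They agree on the window of
      \<open>hsemi n\<close>, and the Lipschitz bound shows that \<open>f\<close> does not see the
      rest.\<close>
    have "hsemi n (segment (P y) t - segment y t) \<le> 0"
    proof (rule hsemi_segment_diff_le)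
      fix r assume "t - real n \<le> r" "r \<le> t"
      then have "?\<rho> (y r - x r) = y r - x r" using t by (intro \<rho>_id near') auto
      then show "norm (P y r - y r) \<le> 0" by (simp add: P_def)
    qed (use t in \<open>auto intro!: cont_P cont_y\<close>)
    then have "hsemi n (segment (P y) t - segment y t) = 0" using hsemi_nonneg[of n "segment (P y) t - segment y t"] by linarith
    with tube_lipschitz[OF tube t P_near[OF cont_y] yt] t
    show "f (segment (P y) t) = f (segment y t)" by simp
  qed
  then have "is_solution f U {0..T} y"
    unfolding is_solution_Icc_iff[OF T] using cont_y der by auto
  then show ?thesis using y(2) by blast
qed

section \<open>The semiflow\<close>

abbreviation "M \<equiv> maximal_solution f U"
abbreviation "esc \<equiv> escape_time f U"

section \<open>Maximal solutions\<close>

lemma solution_imp_escape_time_ge: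
  assumes "0 < T" "is_solution f U {0..T} x" "segment x 0 = \<phi>"
  shows "ereal T \<le> esc \<phi>"
  unfolding escape_time_def using assms by (intro Sup_upper) auto

lemma less_escape_time_imp_solution:
  assumes "0 \<le> t" "ereal t < esc \<phi>"
  shows "\<exists>T x. t < T \<and> is_solution f U {0..T} x \<and> segment x 0 = \<phi>"
  using assms unfolding escape_time_def less_Sup_iff by auto

text \<open>Justifies the choice in \<open>maximal_solution\<close>. Each \<open>t\<close> below the
  escape time has a solution that lives beyond \<open>t\<close>; by uniqueness these pieces agree
  where they overlap and can be glued.\<close>

lemma maximal_solution_exists:
  assumes "0 < esc \<phi>"
  shows "\<exists>x. is_solution f U {t. 0 \<le> t \<and> ereal t < esc \<phi>} x \<and> segment x 0 = \<phi>"
proof -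
  let ?I = "{t. 0 \<le> t \<and> ereal t < esc \<phi>}"
  have "\<forall>t\<in>?I. \<exists>T x. t < T \<and> is_solution f U {0..T} x \<and> segment x 0 = \<phi>"
    using less_escape_time_imp_solution by auto
  from bchoice[OF this] obtain S where
    "\<forall>t\<in>?I. \<exists>x. t < S t \<and> is_solution f U {0..S t} x \<and> segment x 0 = \<phi>" by blast
  from bchoice[OF this] obtain X where
    SX: "\<forall>t\<in>?I. t < S t \<and> is_solution f U {0..S t} (X t) \<and> segment (X t) 0 = \<phi>" by blast
  note S = conjunct1[OF bspec[OF SX]] and X = conjunct1[OF conjunct2[OF bspec[OF SX]]]
    and init = conjunct2[OF conjunct2[OF bspec[OF SX]]]
  have S_esc: "ereal r < esc \<phi>" if "t \<in> ?I" "r < S t" for t r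
  proof -
    have "ereal (S t) \<le> esc \<phi>" using S X init that(1) by (intro solution_imp_escape_time_ge[of "S t" "X t"]) force+
    then show ?thesis using that(2) by (meson ereal_less_eq(3) less_le_trans less_ereal.simps(1))
  qed
  have I0: "0 \<in> ?I" using assms by (simp add: zero_ereal_def)
  \<comment> \<open>Negative times lie outside the index set of the pieces and are served by the
    piece for time \<open>0\<close>.\<close>
  define z where "z t = X (max t 0) t" for t
  have z: "z r = X t r" if t: "t \<in> ?I" and r: "r < S t" for t r
  proof -
    define q where "q = max r 0"
    have q: "q \<in> ?I" using S_esc[OF t r] I0 unfolding q_def by (auto simp: max_def)
    define m where "m = min (S q) (S t)"
    have m: "0 \<le> m" "r \<le> m" using S[OF q] S[OF t] q t r unfolding m_def q_def by auto
    have "X q r = X t r"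
    proof (rule solution_unique)
      show "is_solution f U {0..m} (X q)" "is_solution f U {0..m} (X t)"
        by (rule is_solution_subset[OF X[OF q]] is_solution_subset[OF X[OF t]];
            auto simp: m_def is_interval_cc)+
    qed (use init q t m in auto)
    then show ?thesis unfolding z_def q_def .
  qed
  have cont_X: "continuous_on {..S t} (X t)" if "t \<in> ?I" for t
  proof -
    have "0 \<le> S t" using S[OF that] that by simp
    then show ?thesis using X[OF that] by (simp add: is_solution_Icc_iff)
  qed
  have seg: "segment z t = segment (X t) t" if "t \<in> ?I" for t
    using S[OF that] by (intro segment_cong z that) auto
  have "is_solution f U ?I z"
    unfolding is_solution_def
  proof (intro conjI ballI)
    show "is_interval ?I" unfolding is_interval_1
      by (auto intro: le_less_trans[OF ereal_less_eq(3)[THEN iffD2]])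
    show "continuous_on ({..0} + ?I) z"
    proof (rule continuous_at_imp_continuous_on, rule ballI)
      fix p assume "p \<in> {..0} + ?I"
      then obtain t where t: "t \<in> ?I" "p \<le> t" by (auto elim!: set_plus_elim)
      have "continuous_on {..<S t} z"
        using continuous_on_cong[of "{..<S t}" "{..<S t}" z "X t"] z[OF t(1)]
          continuous_on_subset[OF cont_X[OF t(1)], of "{..<S t}"] by force
      then show "isCont z p" using S[OF t(1)] t(2) by (simp add: continuous_on_eq_continuous_at)
    qed
    fix t assume t: "t \<in> ?I"
    have St: "0 \<le> S t" "t \<in> {0..S t}" using S[OF t] t by auto
    note Xt = X[OF t, unfolded is_solution_Icc_iff[OF St(1)]]
    show "segment z t \<in> U" using Xt St unfolding seg[OF t] by auto
    \<comment> \<open>As \<open>t < S t\<close>, both intervals coincide near \<open>t\<close>, also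
      when \<open>t = 0\<close>.\<close>
    have "at t within {0..S t} = at t within ?I"
      by (rule at_within_nhd[of t "{..<S t}"]) (use S[OF t] S_esc[OF t] in auto)
    then have "(X t has_vector_derivative f (segment z t)) (at t within ?I)"
      using bspec[OF conjunct2[OF Xt] St(2)] unfolding seg[OF t] by simp
    then show "(z has_vector_derivative f (segment z t)) (at t within ?I)"
    proof (rule has_vector_derivative_transform_within)
      show "0 < S t - t" using S[OF t] by simp
      show "X t r = z r" if "r \<in> ?I" "dist r t < S t - t" for r
        using that z[OF t, of r] by (auto simp: dist_real_def)
    qed (use t in auto)
  qed
  moreover have "segment z 0 = \<phi>" using seg[OF I0] init[OF I0] by simp
  ultimately show ?thesis by blast
qed

lemma
  assumes "0 \<le> T" "ereal T < esc \<phi>"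
  shows maximal_solution_Icc: "is_solution f U {0..T} (M \<phi>)"
    and maximal_solution_init: "segment (M \<phi>) 0 = \<phi>"
proof -
  have "0 < esc \<phi>" using assms by (metis ereal_less_eq(3) le_less_trans zero_ereal_def)
  from someI_ex[OF maximal_solution_exists[OF this]]
  have *: "is_solution f U {t. 0 \<le> t \<and> ereal t < esc \<phi>} (M \<phi>)" "segment (M \<phi>) 0 = \<phi>"
    unfolding maximal_solution_def by auto
  show "segment (M \<phi>) 0 = \<phi>" by (rule *(2))
  show "is_solution f U {0..T} (M \<phi>)"
    by (rule is_solution_subset[OF *(1)])
      (use assms in \<open>auto simp: is_interval_cc intro: le_less_trans[OF ereal_less_eq(3)[THEN iffD2]]\<close>)
qed

lemma
  assumes "0 \<le> T" "ereal T < esc \<phi>"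
  shows continuous_on_maximal_solution: "t \<le> T \<Longrightarrow> continuous_on {..t} (M \<phi>)"
    and maximal_solution_segment_in: "t \<in> {0..T} \<Longrightarrow> segment (M \<phi>) t \<in> U"
    and maximal_solution_derivative:
      "t \<in> {0..T} \<Longrightarrow> (M \<phi> has_vector_derivative f (segment (M \<phi>) t)) (at t within {0..T})"
  using maximal_solution_Icc[OF assms] unfolding is_solution_Icc_iff[OF assms(1)]
  by (auto intro: continuous_on_subset)

text \<open>Bundles what the later estimates use near \<open>\<phi>0\<close>: with a single seminorm
  and radius, any two maximal solutions starting there can be compared on \<open>{0..T}\<close> with
  the constants of one tube.\<close>

definition flow_box :: "nat \<Rightarrow> real \<Rightarrow> real \<Rightarrow> 'b history \<Rightarrow> bool" where
  "flow_box n \<delta> T \<phi>0 \<longleftrightarrow> 0 < \<delta> \<and> tube n (M \<phi>0) T \<and>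
    (\<forall>\<phi>. hsemi n (\<phi> - \<phi>0) < \<delta> \<longrightarrow> ereal T < esc \<phi> \<and>
      (\<forall>s\<in>{0..T}. segment (M \<phi>) s \<in> hball n (segment (M \<phi>0) s)))"

lemma ex_flow_box:
  assumes "0 \<le> T" "ereal T < esc \<phi>0"
  shows "\<exists>n \<delta>. flow_box n \<delta> T \<phi>0"
proof -
  \<comment> \<open>A solution on \<open>{0..T'}\<close> gives only
    \<open>T' \<le> esc \<phi>\<close>; the gap yields the strict inequality for \<open>T\<close>.
    It also makes \<open>T'\<close> positive when \<open>T = 0\<close>.\<close>
  obtain T' where T': "T < T'" "ereal T' < esc \<phi>0"
    using ereal_dense2[OF assms(2)] by auto
  then have T'0: "0 < T'" using assms(1) by simp
  have sol: "is_solution f U {0..T'} (M \<phi>0)" and init: "segment (M \<phi>0) 0 = \<phi>0"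
    using maximal_solution_Icc[of T'] maximal_solution_init[of T'] T' T'0 by auto
  obtain n where n: "tube n (M \<phi>0) T'"
    using ex_tube[of T' "M \<phi>0"] sol T'0 by (auto simp: is_solution_Icc_iff)
  define G where "G = growth (real (Suc n)) T'"
  have G: "1 \<le> G" unfolding G_def using T'0 by (intro growth_ge_1) auto
  \<comment> \<open>The threshold at which \<open>solution_exists_near\<close> and
    \<open>solution_stays_close\<close> apply.\<close>
  define \<delta> where "\<delta> = 1 / real (Suc (2 * n + 1)) / G"
  have \<delta>: "0 < \<delta>" unfolding \<delta>_def using G by auto
  have "ereal T < esc \<phi> \<and> (\<forall>s\<in>{0..T}. segment (M \<phi>) s \<in> hball n (segment (M \<phi>0) s))"
    if "hsemi n (\<phi> - \<phi>0) < \<delta>" for \<phi>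
  proof -
    have small: "G * hsemi n (\<phi> - \<phi>0) < 1 / real (Suc (2 * n + 1))"
      using that G unfolding \<delta>_def by (subst (asm) pos_less_divide_eq) (auto simp: mult_ac)
    then obtain y where y: "is_solution f U {0..T'} y" "segment y 0 = \<phi>"
      using solution_exists_near[OF _ n sol, of \<phi>] T'0 init unfolding G_def by auto
    then have "ereal T' \<le> esc \<phi>" using T'0 by (intro solution_imp_escape_time_ge)
    then have T_esc: "ereal T < esc \<phi>" using T'(1) by (meson less_ereal.simps(1) less_le_trans)
    moreover have "segment (M \<phi>) s \<in> hball n (segment (M \<phi>0) s)" if s: "s \<in> {0..T}" for s
    proof -
      \<comment> \<open>\<open>M \<phi>\<close> comes from a choice, so the constructed
        \<open>y\<close> is identified with it by uniqueness.\<close>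
      have eq: "M \<phi> r = y r" if "r \<le> T" for r
      proof (rule solution_unique[OF assms(1) maximal_solution_Icc[OF assms(1) T_esc]])
        show "is_solution f U {0..T} y"
          by (rule is_solution_subset[OF y(1)]) (use T'(1) in \<open>auto simp: is_interval_cc\<close>)
      qed (use maximal_solution_init[OF assms(1) T_esc] y that in auto)
      have "segment y s \<in> hball n (segment (M \<phi>0) s)"
        using small s T' T'0 y init unfolding G_def by (intro solution_stays_close[OF _ n sol]) auto
      moreover have "segment (M \<phi>) s = segment y s" using s by (intro segment_cong eq) auto
      ultimately show ?thesis by simp
    qed
    ultimately show ?thesis by blast
  qed
  then show ?thesis unfolding flow_box_def using \<delta> tube_mono[OF n] T' by (meson less_imp_le)
qed

lemma flow_box_lipschitz:
  assumes box: "flow_box n \<delta> T \<phi>0" and T: "0 \<le> T"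
    and "hsemi n (\<phi> - \<phi>0) < \<delta>" "hsemi n (\<phi>' - \<phi>0) < \<delta>" and t: "t \<in> {0..T}"
  shows "hsemi k (segment (M \<phi>) t - segment (M \<phi>') t) \<le>
    hsemi k (\<phi> - \<phi>') + growth (real (Suc n)) T * hsemi n (\<phi> - \<phi>')"
proof -
  have esc: "ereal T < esc \<phi>" "ereal T < esc \<phi>'"
    and near: "\<And>s. s \<in> {0..T} \<Longrightarrow> segment (M \<phi>) s \<in> hball n (segment (M \<phi>0) s)"
      "\<And>s. s \<in> {0..T} \<Longrightarrow> segment (M \<phi>') s \<in> hball n (segment (M \<phi>0) s)"
    and tube: "tube n (M \<phi>0) T"
    using assms unfolding flow_box_def by auto
  note init = maximal_solution_init[OF T esc(1)] maximal_solution_init[OF T esc(2)]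
  have "hsemi k (segment (M \<phi>) t - segment (M \<phi>') t) \<le>
    hsemi k (segment (M \<phi>) 0 - segment (M \<phi>') 0) + growth (real (Suc n)) T * hsemi n (\<phi> - \<phi>')"
  proof (rule hsemi_segment_diff_le_add)
    fix s assume "s \<in> {0..t}"
    then show "norm (M \<phi> s - M \<phi>' s) \<le> growth (real (Suc n)) T * hsemi n (\<phi> - \<phi>')"
      using solutions_close[OF T tube maximal_solution_Icc[OF T esc(1)] near(1)
          maximal_solution_Icc[OF T esc(2)] near(2), of s] t unfolding init by auto
  qed (use t T esc growth_ge_1[of "real (Suc n)" T] in
      \<open>auto intro!: mult_nonneg_nonneg hsemi_nonneg continuous_on_maximal_solution[OF T]\<close>)
  then show ?thesis unfolding init .
qed

lemma flow_box_center: "flow_box n \<delta> T \<phi>0 \<Longrightarrow> hsemi n (\<phi>0 - \<phi>0) < \<delta>"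
  unfolding flow_box_def by (simp add: hsemi_zero)

text \<open>The difference is split at \<open>segment (M \<phi>0) t\<close>: changing the history is
  Lipschitz uniformly for \<open>t \<le> T\<close>, and changing the time moves along one continuous
  curve of segments.\<close>

lemma continuous_on_semiflow: "continuous_on (semiflow_domain f U) (semiflow f U)"
  unfolding continuous_on_def tendsto_history_iff
proof (intro ballI allI)
  fix p0 k assume p0: "p0 \<in> semiflow_domain f U"
  obtain t0 \<phi>0 where p0_eq: "p0 = (t0, \<phi>0)" by fastforce
  have t0: "0 \<le> t0" "ereal t0 < esc \<phi>0" using p0 unfolding p0_eq semiflow_domain_def by auto
  obtain T where T: "t0 < T" "ereal T < esc \<phi>0" using ereal_dense2[OF t0(2)] by auto
  have T0: "0 \<le> T" using t0(1) T(1) by simp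
  obtain n \<delta> where box: "flow_box n \<delta> T \<phi>0" using ex_flow_box[OF T0 T(2)] by blast
  let ?F = "at p0 within semiflow_domain f U"
  let ?G = "growth (real (Suc n)) T"
  define b where "b p = (hsemi k (snd p - \<phi>0) + ?G * hsemi n (snd p - \<phi>0)) +
    hsemi k (segment (M \<phi>0) (fst p) - segment (M \<phi>0) t0)" for p
  have "(snd \<longlongrightarrow> \<phi>0) ?F" using tendsto_snd[OF tendsto_ident_at, of p0] unfolding p0_eq by simp
  then have snd: "((\<lambda>p. hsemi j (snd p - \<phi>0)) \<longlongrightarrow> 0) ?F" for j unfolding tendsto_history_iff by blast
  have fst: "(fst \<longlongrightarrow> t0) ?F" using tendsto_fst[OF tendsto_ident_at, of p0] unfolding p0_eq by simp
  \<comment> \<open>The half-line is open and contains \<open>t0\<close>, as \<open>T\<close> was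
    chosen beyond \<open>t0\<close>; hence continuity at \<open>t0\<close> is two-sided.\<close>
  have "continuous_on {..<T} (segment (M \<phi>0))"
    by (rule continuous_on_subset[OF continuous_on_segment[OF continuous_on_maximal_solution[OF T0 T(2) order_refl]]]) auto
  then have "isCont (segment (M \<phi>0)) t0" using T(1) by (simp add: continuous_on_eq_continuous_at)
  from isCont_tendsto_compose[OF this fst]
  have "((\<lambda>p. hsemi k (segment (M \<phi>0) (fst p) - segment (M \<phi>0) t0)) \<longlongrightarrow> 0) ?F"
    unfolding tendsto_history_iff by blast
  then have "(b \<longlongrightarrow> (0 + ?G * 0) + 0) ?F" unfolding b_def
    by (intro tendsto_add tendsto_mult tendsto_const snd)
  then have b: "(b \<longlongrightarrow> 0) ?F" by simp
  have "\<forall>\<^sub>F p in ?F. p \<in> semiflow_domain f U" by (simp add: eventually_at_filter)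
  moreover have "\<forall>\<^sub>F p in ?F. fst p < T" using order_tendstoD(2)[OF fst T(1)] .
  moreover have "\<forall>\<^sub>F p in ?F. hsemi n (snd p - \<phi>0) < \<delta>"
    using order_tendstoD(2)[OF snd] box unfolding flow_box_def by auto
  ultimately have "\<forall>\<^sub>F p in ?F. hsemi k (semiflow f U p - semiflow f U p0) \<le> b p"
  proof eventually_elim
    case (elim p)
    obtain t \<phi> where p: "p = (t, \<phi>)" by fastforce
    have "hsemi k (segment (M \<phi>) t - segment (M \<phi>0) t) \<le> hsemi k (\<phi> - \<phi>0) + ?G * hsemi n (\<phi> - \<phi>0)"
      using elim by (intro flow_box_lipschitz[OF box T0] flow_box_center[OF box]) (auto simp: p semiflow_domain_def)
    then show ?case
      using hsemi_diff_triangle[of k "segment (M \<phi>) t" "segment (M \<phi>0) t0" "segment (M \<phi>0) t"]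
      unfolding b_def semiflow_def p p0_eq by simp
  qed
  then show "((\<lambda>p. hsemi k (semiflow f U p - semiflow f U p0)) \<longlongrightarrow> 0) ?F"
    by (intro tendsto_sandwich[OF _ _ tendsto_const b]) (auto simp: hsemi_nonneg)
qed

lemma semiflow_in: "semiflow f U \<in> semiflow_domain f U \<rightarrow> U"
  by (auto simp: semiflow_def semiflow_domain_def intro!: maximal_solution_segment_in)

text \<open>An escape time beyond \<open>t\<close> already implies \<open>\<phi> \<in> U\<close>,
  since \<open>\<phi>\<close> is the segment at time \<open>0\<close> of a solution.\<close>

lemma mem_solution_operator_domain:
  assumes "0 \<le> t"
  shows "\<phi> \<in> solution_operator_domain f U t \<longleftrightarrow> ereal t < esc \<phi>"
  using maximal_solution_segment_in[of t \<phi> 0] maximal_solution_init[of t \<phi>] assms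
  unfolding solution_operator_domain_def semiflow_domain_def by auto

lemma open_solution_operator_domain:
  assumes "0 \<le> t"
  shows "open (solution_operator_domain f U t)"
  unfolding open_history_def mem_solution_operator_domain[OF assms]
proof
  fix \<phi> assume "\<phi> \<in> solution_operator_domain f U t"
  then obtain n \<delta> where "flow_box n \<delta> t \<phi>" using ex_flow_box assms mem_solution_operator_domain by blast
  then show "\<exists>j. \<exists>e>0. \<forall>\<psi>. hsemi j (\<psi> - \<phi>) < e \<longrightarrow> ereal t < esc \<psi>"
    unfolding flow_box_def by blast
qed

lemma solution_operator_eq: "solution_operator f U t \<phi> = segment (M \<phi>) t"
  by (simp add: solution_operator_def semiflow_def)

lemma continuous_on_solution_operator:
  assumes "0 \<le> t"
  shows "continuous_on (solution_operator_domain f U t) (solution_operator f U t)"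
  unfolding solution_operator_def
  by (rule continuous_on_compose2[OF continuous_on_semiflow])
    (auto intro!: continuous_intros simp: solution_operator_domain_def)

end

section \<open>The linearized equation\<close>

context mb_smooth
begin

text \<open>The initial value is left free, so that for fixed \<open>T\<close> below the escape time
  of \<open>\<phi>\<close> the solutions are closed under linear combinations.\<close>

definition variational :: "real \<Rightarrow> 'b history \<Rightarrow> (real \<Rightarrow> 'b) \<Rightarrow> bool" where
  "variational T \<phi> w \<longleftrightarrow> continuous_on {..T} w \<and> (\<forall>t\<in>{0..T}.
     (w has_vector_derivative Df (segment (M \<phi>) t) (segment w t)) (at t within {0..T}))"

lemma variational_continuous: "variational T \<phi> w \<Longrightarrow> t \<le> T \<Longrightarrow> continuous_on {..t} w"
  unfolding variational_def by (auto intro: continuous_on_subset)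

text \<open>The tube bound, taken at the centres of its balls, makes the linear right-hand side
  Lipschitz, so \<open>picard_existence\<close> applies on all of \<open>{0..T}\<close>.\<close>

lemma ex_variational:
  assumes T: "0 \<le> T" "ereal T < esc \<phi>"
  shows "\<exists>w. variational T \<phi> w \<and> segment w 0 = v"
proof -
  note in_U = maximal_solution_segment_in[OF T] and cont_M = continuous_on_maximal_solution[OF T]
  obtain n where n: "tube n (M \<phi>) T" using ex_tube[OF cont_M in_U] by auto
  obtain w where w: "continuous_on UNIV w" "segment w 0 = v"
    and der: "\<And>t. t \<in> {0..T} \<Longrightarrow> (w has_vector_derivative Df (segment (M \<phi>) t) (segment w t)) (at t within {0..T})"
  proof (rule picard_existence[where \<Phi>="\<lambda>w s. Df (segment (M \<phi>) s) (segment w s)" and T=T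
        and L="real (Suc n)" and \<phi>=v])
    fix w :: "real \<Rightarrow> 'b" assume w: "continuous_on UNIV w"
    show "continuous_on {0..T} (\<lambda>s. Df (segment (M \<phi>) s) (segment w s))"
    proof (rule continuous_on_Df)
      show "continuous_on {0..T} (segment (M \<phi>))"
        by (rule continuous_on_subset[OF continuous_on_segment[OF cont_M[OF order_refl]]]) auto
      show "continuous_on {0..T} (segment w)"
        by (rule continuous_on_subset[OF continuous_on_segment[OF continuous_on_subset[OF w], of T]]) auto
    qed (rule in_U)
  next
    fix w w' :: "real \<Rightarrow> 'b" and s B assume *: "continuous_on UNIV w" "continuous_on UNIV w'" "s \<in> {0..T}"
      "\<And>r. r \<le> s \<Longrightarrow> norm (w r - w' r) \<le> B"
    have "hsemi n (segment w s - segment w' s) \<le> B"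
      by (intro hsemi_segment_diff_le continuous_on_subset[OF *(1)] continuous_on_subset[OF *(2)] *(4)) auto
    then have "real (Suc n) * hsemi n (segment w s - segment w' s) \<le> real (Suc n) * B"
      by (intro mult_left_mono) auto
    moreover have "norm (Df (segment (M \<phi>) s) (segment w s - segment w' s)) \<le>
        real (Suc n) * hsemi n (segment w s - segment w' s)"
      using n *(3) center_in_hball unfolding tube_def by blast
    ultimately have "norm (Df (segment (M \<phi>) s) (segment w s - segment w' s)) \<le> real (Suc n) * B"
      by linarith
    then show "norm (Df (segment (M \<phi>) s) (segment w s) - Df (segment (M \<phi>) s) (segment w' s)) \<le> real (Suc n) * B"
      using in_U[OF *(3)] by (simp add: Df_diff)
  qed (use T in auto)
  have "variational T \<phi> w" unfolding variational_def using der w(1) by (auto intro: continuous_on_subset)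
  then show ?thesis using w(2) by blast
qed

lemma variational_add_scaleR:
  assumes T: "0 \<le> T" "ereal T < esc \<phi>" and w: "variational T \<phi> w" and w': "variational T \<phi> w'"
  shows "variational T \<phi> (\<lambda>r. w r + c *\<^sub>R w' r)"
  unfolding variational_def
proof (intro conjI ballI)
  show "continuous_on {..T} (\<lambda>r. w r + c *\<^sub>R w' r)"
    by (intro continuous_intros variational_continuous[OF w] variational_continuous[OF w']) auto
  fix t assume t: "t \<in> {0..T}"
  have "((\<lambda>r. w r + c *\<^sub>R w' r) has_vector_derivative
      Df (segment (M \<phi>) t) (segment w t) + c *\<^sub>R Df (segment (M \<phi>) t) (segment w' t)) (at t within {0..T})"
    using w w' t unfolding variational_def
    by (intro has_vector_derivative_add bounded_linear.has_vector_derivative[OF bounded_linear_scaleR_right]) auto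
  moreover have "segment (\<lambda>r. w r + c *\<^sub>R w' r) t = segment w t + c *\<^sub>R segment w' t"
    using t by (intro segment_add_scaleR variational_continuous[OF w] variational_continuous[OF w']) auto
  ultimately show "((\<lambda>r. w r + c *\<^sub>R w' r) has_vector_derivative
      Df (segment (M \<phi>) t) (segment (\<lambda>r. w r + c *\<^sub>R w' r) t)) (at t within {0..T})"
    using maximal_solution_segment_in[OF T t] by (simp add: Df_add Df_scaleR)
qed

lemma variational_zero:
  assumes "0 \<le> T" "ereal T < esc \<phi>"
  shows "variational T \<phi> (\<lambda>_. 0)"
  unfolding variational_def segment_const_0
  using maximal_solution_segment_in[OF assms] by (auto simp: Df_zero)

text \<open>The difference of the right-hand sides is split so that the perturbed base point acts on
  \<open>w - w0\<close>, where the tube bound holds, and the change of base point acts on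
  \<open>w0\<close> alone. Thus \<open>e\<close> involves only the unperturbed solution. For
  \<open>w0 = 0\<close> this is an a priori bound.\<close>

lemma variational_diff_le:
  assumes box: "flow_box n \<delta> T \<phi>0" and T: "0 \<le> T" and \<phi>: "hsemi n (\<phi> - \<phi>0) < \<delta>"
    and w: "variational T \<phi> w" and w0: "variational T \<phi>0 w0" and e: "0 \<le> e"
    and le: "\<And>s. s \<in> {0..T} \<Longrightarrow>
      norm (Df (segment (M \<phi>) s) (segment w0 s) - Df (segment (M \<phi>0) s) (segment w0 s)) \<le> e"
    and t: "t \<in> {0..T}"
  shows "hsemi k (segment w t - segment w0 t) \<le> hsemi k (segment w 0 - segment w0 0) +
    growth (real (Suc n)) T * (hsemi n (segment w 0 - segment w0 0) + e)"
proof -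
  let ?G = "growth (real (Suc n)) T"
  have esc: "ereal T < esc \<phi>" using box \<phi> unfolding flow_box_def by auto
  note cont_w = variational_continuous[OF w] and cont_w0 = variational_continuous[OF w0]
  have norm_le: "norm (w s - w0 s) \<le> ?G * (hsemi n (segment w 0 - segment w0 0) + e)" if s: "s \<in> {0..T}" for s
  proof (rule delay_gronwall[where d="\<lambda>s. w s - w0 s" and n=n and
        d'="\<lambda>s. Df (segment (M \<phi>) s) (segment w s) - Df (segment (M \<phi>0) s) (segment w0 s)"])
    show "continuous_on {..T} (\<lambda>s. w s - w0 s)" by (intro continuous_intros cont_w cont_w0) auto
    show "norm (w r - w0 r) \<le> hsemi n (segment w 0 - segment w0 0)" if "- real n \<le> r" "r \<le> 0" for r
      using that T by (intro norm_le_hsemi_segment_diff cont_w cont_w0) auto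
    fix s assume s: "s \<in> {0..T}"
    show "((\<lambda>s. w s - w0 s) has_vector_derivative
        Df (segment (M \<phi>) s) (segment w s) - Df (segment (M \<phi>0) s) (segment w0 s)) (at s within {0..T})"
      using w w0 s unfolding variational_def by (intro has_vector_derivative_diff) auto
    have U: "segment (M \<phi>) s \<in> U" by (rule maximal_solution_segment_in[OF T esc s])
    have "Df (segment (M \<phi>) s) (segment w s) - Df (segment (M \<phi>0) s) (segment w0 s) =
        Df (segment (M \<phi>) s) (segment w s - segment w0 s) +
        (Df (segment (M \<phi>) s) (segment w0 s) - Df (segment (M \<phi>0) s) (segment w0 s))"
      by (simp add: Df_diff[OF U])
    also have "norm \<dots> \<le> real (Suc n) * hsemi n (segment w s - segment w0 s) + e"
    proof (rule norm_triangle_mono[OF _ le[OF s]])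
      show "norm (Df (segment (M \<phi>) s) (segment w s - segment w0 s)) \<le>
          real (Suc n) * hsemi n (segment w s - segment w0 s)"
        using box \<phi> s unfolding flow_box_def tube_def by blast
    qed
    finally show "norm (Df (segment (M \<phi>) s) (segment w s) - Df (segment (M \<phi>0) s) (segment w0 s)) \<le>
        real (Suc n) * hsemi n (segment (\<lambda>s. w s - w0 s) s) + e"
      using s by (simp add: segment_diff cont_w cont_w0)
  qed (use s e in auto)
  show ?thesis
    using t T e growth_ge_1[of "real (Suc n)" T]
    by (intro hsemi_segment_diff_le_add cont_w cont_w0 mult_nonneg_nonneg add_nonneg_nonneg hsemi_nonneg norm_le) auto
qed

text \<open>Continuity of \<open>Df\<close> at the pairs \<open>(segment x s, segment w s)\<close>
  is made uniform over the compact interval. The direction is tied to the curve of \<open>w\<close>,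
  as \<open>C1_MB\<close> controls \<open>Df\<close> only near a given direction.\<close>

lemma Df_uniform:
  assumes x: "continuous_on {..T} x" "\<And>s. s \<in> {0..T} \<Longrightarrow> segment x s \<in> U"
    and w: "continuous_on {..T} w" and e: "0 < e"
  shows "\<exists>n. \<forall>s\<in>{0..T}. \<forall>\<psi>\<in>hball n (segment x s).
    norm (Df \<psi> (segment w s) - Df (segment x s) (segment w s)) < e"
proof (rule uniform_index)
  show "\<forall>\<psi>\<in>hball n (segment x s). norm (Df \<psi> (segment w s) - Df (segment x s) (segment w s)) < e"
    if "\<forall>\<psi>\<in>hball m (segment x s). norm (Df \<psi> (segment w s) - Df (segment x s) (segment w s)) < e" "m \<le> n" for s m n
    using that hball_antimono[OF that(2), of "segment x s"] by auto
  fix s assume s: "s \<in> {0..T}"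
  obtain m where m: "\<And>\<psi> v. \<psi> \<in> hball m (segment x s) \<Longrightarrow> v \<in> hball m (segment w s) \<Longrightarrow>
      norm (Df \<psi> v - Df (segment x s) (segment w s)) < e / 2"
    using Df_near[OF x(2)[OF s], of "e / 2" "segment w s"] e by auto
  \<comment> \<open>Halving concerns the base point only, which moves twice: from
    \<open>segment x s\<close> to \<open>segment x r\<close> and on to
    \<open>\<psi>\<close>.\<close>
  define n where "n = 2 * m + 1"
  obtain d1 where d1: "0 < d1" "\<And>r. r \<in> {0..T} \<Longrightarrow> \<bar>r - s\<bar> < d1 \<Longrightarrow> segment x r \<in> hball n (segment x s)"
    using segment_near[OF x(1) s] by blast
  obtain d2 where d2: "0 < d2" "\<And>r. r \<in> {0..T} \<Longrightarrow> \<bar>r - s\<bar> < d2 \<Longrightarrow> segment w r \<in> hball m (segment w s)"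
    using segment_near[OF w s] by blast
  have "norm (Df \<psi> (segment w r) - Df (segment x r) (segment w r)) < e"
    if r: "r \<in> {0..T}" "\<bar>r - s\<bar> < min d1 d2" and \<psi>: "\<psi> \<in> hball n (segment x r)" for r \<psi>
  proof -
    let ?c = "Df (segment x s) (segment w s)"
    have sub: "hball n (segment x r) \<subseteq> hball m (segment x s)"
      using d1(2)[OF r(1)] r(2) unfolding n_def by (intro hball_half_subset) auto
    have wr: "segment w r \<in> hball m (segment w s)" using d2(2) r by auto
    have "norm (Df \<psi> (segment w r) - ?c) < e / 2" using sub \<psi> wr by (intro m) auto
    moreover have "norm (?c - Df (segment x r) (segment w r)) < e / 2"
      using m[OF _ wr, of "segment x r"] sub center_in_hball by (subst norm_minus_commute) blast
    ultimately show ?thesis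
      using norm_triangle_ineq[of "Df \<psi> (segment w r) - ?c" "?c - Df (segment x r) (segment w r)"] by simp
  qed
  then show "\<exists>n. \<exists>d>0. \<forall>r\<in>{0..T}. \<bar>r - s\<bar> < d \<longrightarrow> (\<forall>\<psi>\<in>hball n (segment x r).
      norm (Df \<psi> (segment w r) - Df (segment x r) (segment w r)) < e)"
    using d1(1) d2(1) by (intro exI[of _ n] exI[of _ "min d1 d2"]) auto
qed

lemma variational_is_derivative:
  assumes T: "0 \<le> T" "ereal T < esc \<phi>" and w: "variational T \<phi> w"
  shows "((\<lambda>h. (1 / h) *\<^sub>R (segment (M (\<phi> + h *\<^sub>R segment w 0)) T - segment (M \<phi>) T)) \<longlongrightarrow> segment w T) (at 0)"
  unfolding tendsto_history_iff
proof (intro allI tendstoI)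
  fix k and e :: real assume e: "0 < e"
  define v where "v = segment w 0"
  let ?x = "M \<phi>"
  obtain n \<delta> where box: "flow_box n \<delta> T \<phi>" using ex_flow_box[OF T] by blast
  have \<delta>: "0 < \<delta>" and tube: "tube n ?x T" using box unfolding flow_box_def by auto
  let ?G = "growth (real (Suc n)) T"
  have G: "1 \<le> ?G" using T by (intro growth_ge_1) auto
  \<comment> \<open>The linearization error is multiplied by \<open>?G\<close> in the Gronwall
    estimate and ends up as \<open>e / 2\<close>.\<close>
  define \<eta> where "\<eta> = e / (2 * ?G)"
  have \<eta>: "0 < \<eta>" "?G * \<eta> < e" unfolding \<eta>_def using G e by (auto simp: field_simps)
  note cont_x = continuous_on_maximal_solution[OF T] and in_U = maximal_solution_segment_in[OF T]
    and cont_w = variational_continuous[OF w]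
  from Df_uniform[OF cont_x[OF order_refl] in_U cont_w[OF order_refl] \<eta>(1)]
  obtain N where N: "\<forall>s\<in>{0..T}. \<forall>\<psi>\<in>hball N (segment ?x s).
      norm (Df \<psi> (segment w s) - Df (segment ?x s) (segment w s)) < \<eta>" by blast
  \<comment> \<open>Points in a ball of index \<open>j\<close> are both in the tube and where the
    derivative is within \<open>\<eta>\<close> of its value at the centre.\<close>
  define j where "j = max N n"
  have "compact (w ` {- real j..T})"
    by (intro compact_continuous_image continuous_on_subset[OF cont_w[of T]]) auto
  then obtain W where W: "0 < W" "\<And>r. r \<in> {- real j..T} \<Longrightarrow> norm (w r) \<le> W"
    using compact_imp_bounded bounded_pos by (metis imageI)
  have W_seg: "hsemi j (segment w s) \<le> W" if "s \<in> {0..T}" for s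
    using that by (intro hsemi_le) (auto simp: happly_segment[OF cont_w] intro!: W(2))
  \<comment> \<open>The second condition keeps \<open>segment x s + h *\<^sub>R segment w s\<close>
    in the ball of index \<open>j\<close> for all \<open>s\<close>; the third puts
    \<open>\<phi> + h *\<^sub>R v\<close> into the flow box, with \<open>1\<close> added to have a
    positive divisor.\<close>
  have "\<forall>\<^sub>F h in at 0. h \<noteq> 0 \<and> \<bar>h\<bar> * W < 1 / real (Suc j) \<and> \<bar>h\<bar> * (hsemi n v + 1) < \<delta>"
    unfolding eventually_at using W(1) \<delta> hsemi_nonneg[of n v]
    by (intro exI[of _ "min (1 / real (Suc j) / W) (\<delta> / (hsemi n v + 1))"])
      (auto simp: pos_less_divide_eq mult_ac)
  then show "\<forall>\<^sub>F h in at 0. dist (hsemi k ((1 / h) *\<^sub>R (segment (M (\<phi> + h *\<^sub>R segment w 0)) T - segment ?x T) - segment w T)) 0 < e"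
    unfolding v_def[symmetric]
  proof eventually_elim
    case (elim h)
    then have h: "h \<noteq> 0" by simp
    let ?y = "M (\<phi> + h *\<^sub>R v)"
    have "\<bar>h\<bar> * hsemi n v \<le> \<bar>h\<bar> * (hsemi n v + 1)" by (intro mult_left_mono) auto
    then have "\<bar>h\<bar> * hsemi n v < \<delta>" using elim by linarith
    then have "hsemi n ((\<phi> + h *\<^sub>R v) - \<phi>) < \<delta>" by (simp add: hsemi_scaleR)
    then have esc_y: "ereal T < esc (\<phi> + h *\<^sub>R v)"
      and y_near: "\<And>s. s \<in> {0..T} \<Longrightarrow> segment ?y s \<in> hball n (segment ?x s)"
      using box unfolding flow_box_def by auto
    note cont_y = continuous_on_maximal_solution[OF T(1) esc_y]
    have xw_near: "segment ?x s + (\<theta> * h) *\<^sub>R segment w s \<in> hball j (segment ?x s)"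
      if s: "s \<in> {0..T}" and \<theta>: "0 \<le> \<theta>" "\<theta> \<le> 1" for s \<theta>
    proof -
      have "\<bar>\<theta> * h\<bar> * hsemi j (segment w s) \<le> \<bar>h\<bar> * W"
        using \<theta> W_seg[OF s] by (intro mult_mono) (auto simp: abs_mult hsemi_nonneg mult_left_le_one_le)
      then show ?thesis using elim by (simp add: hball_def hsemi_scaleR)
    qed
    define a where "a r = (1 / h) *\<^sub>R (?y r - ?x r)" for r
    have cont_a: "continuous_on {..s} a" if "s \<le> T" for s
      unfolding a_def by (intro continuous_intros cont_y cont_x that)
    have seg_a: "segment a s = (1 / h) *\<^sub>R (segment ?y s - segment ?x s)" if "s \<le> T" for s
      using that by (intro segment_eqI cont_a)
        (auto simp: a_def happly_simps happly_segment[OF cont_y] happly_segment[OF cont_x])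
    have a0: "segment a 0 = segment w 0"
      using seg_a[of 0] T h maximal_solution_init[OF T(1) esc_y] maximal_solution_init[OF T] by (simp add: v_def)
    have norm_le: "norm (a t - w t) \<le> ?G * (0 + \<eta>)" if t: "t \<in> {0..T}" for t
    proof (rule delay_gronwall[where d="\<lambda>t. a t - w t" and n=n and
          d'="\<lambda>s. (1 / h) *\<^sub>R (f (segment ?y s) - f (segment ?x s)) - Df (segment ?x s) (segment w s)"])
      show "continuous_on {..T} (\<lambda>t. a t - w t)" by (intro continuous_intros cont_a cont_w) auto
      show "norm (a r - w r) \<le> 0" if "- real n \<le> r" "r \<le> 0" for r
        using norm_le_hsemi_segment_diff[of 0 a w n r] that T a0 cont_a cont_w by (auto simp: hsemi_zero)
      fix s assume s: "s \<in> {0..T}"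
      have "(a has_vector_derivative (1 / h) *\<^sub>R (f (segment ?y s) - f (segment ?x s))) (at s within {0..T})"
        unfolding a_def
        by (intro bounded_linear.has_vector_derivative[OF bounded_linear_scaleR_right] has_vector_derivative_diff
            maximal_solution_derivative T esc_y s)
      then show "((\<lambda>t. a t - w t) has_vector_derivative
          (1 / h) *\<^sub>R (f (segment ?y s) - f (segment ?x s)) - Df (segment ?x s) (segment w s)) (at s within {0..T})"
        using w s unfolding variational_def by (intro has_vector_derivative_diff) auto
      \<comment> \<open>From \<open>segment y s\<close> to \<open>?z\<close> the displacement is
        \<open>h\<close> times the deviation of the quotient from \<open>w\<close>, which feeds the
        Gronwall estimate. From \<open>?z\<close> to \<open>segment x s\<close> the direction is
        that of \<open>w\<close>, where the uniform bound \<open>N\<close> applies.\<close>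
      let ?z = "segment ?x s + h *\<^sub>R segment w s"
      have z_near: "?z \<in> hball n (segment ?x s)"
        using xw_near[OF s, of 1] hball_antimono[of n j "segment ?x s"] unfolding j_def by auto
      have "norm (f (segment ?y s) - f ?z) \<le> real (Suc n) * hsemi n (segment ?y s - ?z)"
        by (rule tube_lipschitz[OF tube s y_near[OF s] z_near])
      also have "segment ?y s - ?z = h *\<^sub>R (segment a s - segment w s)"
        using s h by (simp add: seg_a algebra_simps)
      finally have 1: "norm (f (segment ?y s) - f ?z) \<le> \<bar>h\<bar> * (real (Suc n) * hsemi n (segment a s - segment w s))"
        by (simp add: hsemi_scaleR mult_ac)
      have 2: "norm (f ?z - f (segment ?x s) - h *\<^sub>R Df (segment ?x s) (segment w s)) \<le> \<bar>h\<bar> * \<eta>"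
      proof (rule mean_value)
        fix \<theta> :: real assume \<theta>: "0 \<le> \<theta>" "\<theta> \<le> 1"
        let ?p = "segment ?x s + \<theta> *\<^sub>R h *\<^sub>R segment w s"
        have p: "?p \<in> hball j (segment ?x s)" using xw_near[OF s \<theta>] by simp
        then have "?p \<in> hball n (segment ?x s)" "?p \<in> hball N (segment ?x s)"
          using hball_antimono[of n j "segment ?x s"] hball_antimono[of N j "segment ?x s"] unfolding j_def by auto
        then show pU: "?p \<in> U" using tube s unfolding tube_def by blast
        have "norm (Df ?p (segment w s) - Df (segment ?x s) (segment w s)) \<le> \<eta>"
          using N s \<open>?p \<in> hball N (segment ?x s)\<close> by (auto intro: less_imp_le)
        then show "norm (Df ?p (h *\<^sub>R segment w s) - h *\<^sub>R Df (segment ?x s) (segment w s)) \<le> \<bar>h\<bar> * \<eta>"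
          unfolding Df_scaleR[OF pU] scaleR_diff_right[symmetric] norm_scaleR by (intro mult_left_mono) auto
      qed
      have "(1 / h) *\<^sub>R (f (segment ?y s) - f (segment ?x s)) - Df (segment ?x s) (segment w s) =
          (1 / h) *\<^sub>R ((f (segment ?y s) - f ?z) +
            (f ?z - f (segment ?x s) - h *\<^sub>R Df (segment ?x s) (segment w s)))"
        using h by (simp add: algebra_simps)
      also have "norm \<dots> \<le> (1 / \<bar>h\<bar>) * (\<bar>h\<bar> * (real (Suc n) * hsemi n (segment a s - segment w s)) + \<bar>h\<bar> * \<eta>)"
        unfolding norm_scaleR by (intro mult_mono norm_triangle_mono 1 2) auto
      also have "\<dots> = real (Suc n) * hsemi n (segment a s - segment w s) + \<eta>"
        using h by (simp add: field_simps)
      finally show "norm ((1 / h) *\<^sub>R (f (segment ?y s) - f (segment ?x s)) - Df (segment ?x s) (segment w s)) \<le>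
          real (Suc n) * hsemi n (segment (\<lambda>t. a t - w t) s) + \<eta>"
        using s by (simp add: segment_diff cont_a cont_w)
    qed (use t \<eta> in auto)
    have "hsemi k (segment a T - segment w T) \<le> hsemi k (segment a 0 - segment w 0) + ?G * (0 + \<eta>)"
      using T \<eta> G by (intro hsemi_segment_diff_le_add cont_a cont_w norm_le) auto
    then have "hsemi k (segment a T - segment w T) < e" using \<eta> by (simp add: a0 hsemi_zero)
    then show ?case by (simp add: seg_a hsemi_nonneg)
  qed
qed

section \<open>The derivative of the solution operators\<close>

abbreviation "D\<Sigma> t \<equiv> dir_deriv (solution_operator f U t)"

lemma
  assumes t: "0 \<le> t" "ereal t < esc \<phi>" and w: "variational t \<phi> w" "segment w 0 = v"
  shows dir_differentiable_solution_operator_variational: "dir_differentiable (solution_operator f U t) \<phi> v"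
    and dir_deriv_solution_operator: "D\<Sigma> t \<phi> v = segment w t"
  using variational_is_derivative[OF t w(1)] w(2)
    dir_derivI[where g="solution_operator f U t" and u=\<phi> and v=v and w="segment w t"]
  by (simp_all add: solution_operator_eq)

lemma dir_differentiable_solution_operator:
  assumes "0 \<le> t" "ereal t < esc \<phi>"
  shows "dir_differentiable (solution_operator f U t) \<phi> v"
  using ex_variational[OF assms, of v] dir_differentiable_solution_operator_variational[OF assms] by blast

text \<open>Any solution of the linearized equation with the right initial value computes the
  derivative, so superposition of solutions gives linearity.\<close>

lemma linear_dir_deriv_solution_operator:
  assumes t: "0 \<le> t" "ereal t < esc \<phi>"
  shows "linear (D\<Sigma> t \<phi>)"
proof -
  have *: "D\<Sigma> t \<phi> (u + c *\<^sub>R v) = D\<Sigma> t \<phi> u + c *\<^sub>R D\<Sigma> t \<phi> v" for u v c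
  proof -
    obtain w where w: "variational t \<phi> w" "segment w 0 = u" using ex_variational[OF t] by blast
    obtain w' where w': "variational t \<phi> w'" "segment w' 0 = v" using ex_variational[OF t] by blast
    have cont: "continuous_on {..s} w" "continuous_on {..s} w'" if "s \<le> t" for s
      using that w w' variational_continuous by auto
    have "segment (\<lambda>r. w r + c *\<^sub>R w' r) 0 = u + c *\<^sub>R v"
      using w w' t by (simp add: segment_add_scaleR cont)
    from dir_deriv_solution_operator[OF t variational_add_scaleR[OF t w(1) w'(1)] this]
    show ?thesis
      using dir_deriv_solution_operator[OF t w] dir_deriv_solution_operator[OF t w']
      by (simp add: segment_add_scaleR cont)
  qed
  have zero: "D\<Sigma> t \<phi> 0 = 0"
    using dir_deriv_solution_operator[OF t variational_zero[OF t] segment_const_0] by (simp add: segment_const_0)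
  show ?thesis
  proof (rule linearI)
    show "D\<Sigma> t \<phi> (u + v) = D\<Sigma> t \<phi> u + D\<Sigma> t \<phi> v" for u v using *[of u 1 v] by simp
    show "D\<Sigma> t \<phi> (c *\<^sub>R v) = c *\<^sub>R D\<Sigma> t \<phi> v" for c v using *[of 0 c v] zero by simp
  qed
qed

text \<open>Shrinks the neighbourhood until all solutions stay in balls of a prescribed index
  \<open>N\<close>, the one on which \<open>Df_uniform\<close> or \<open>Df_uniform_bounded\<close>
  holds.\<close>

lemma flow_box_near:
  assumes box: "flow_box n \<delta> T \<phi>0" and T: "0 \<le> T"
  shows "\<exists>m. \<forall>\<phi>\<in>hball m \<phi>0. hsemi n (\<phi> - \<phi>0) < \<delta> \<and>
    (\<forall>s\<in>{0..T}. segment (M \<phi>) s \<in> hball N (segment (M \<phi>0) s))"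
proof -
  let ?G = "growth (real (Suc n)) T"
  have G: "1 \<le> ?G" using T by (intro growth_ge_1) auto
  \<comment> \<open>By \<open>flow_box_lipschitz\<close>, initial distances below
    \<open>\<rho>\<close> grow to less than \<open>\<rho> + ?G * \<rho>\<close>.\<close>
  define \<rho> where "\<rho> = min \<delta> (1 / real (Suc N) / (1 + ?G))"
  have \<rho>: "0 < \<rho>" "\<rho> \<le> \<delta>" using box G unfolding \<rho>_def flow_box_def by auto
  have "(1 + ?G) * \<rho> \<le> (1 + ?G) * (1 / real (Suc N) / (1 + ?G))"
    unfolding \<rho>_def using G by (intro mult_left_mono) auto
  also have "\<dots> = 1 / real (Suc N)" using G by (simp del: of_nat_Suc)
  finally have \<rho>_le: "(1 + ?G) * \<rho> \<le> 1 / real (Suc N)" .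
  obtain m where m: "hball m \<phi>0 \<subseteq> {\<phi>. hsemi (max n N) (\<phi> - \<phi>0) < \<rho>}"
    using ex_hball_subset[OF \<rho>(1)] by blast
  have "hsemi n (\<phi> - \<phi>0) < \<delta> \<and> (\<forall>s\<in>{0..T}. segment (M \<phi>) s \<in> hball N (segment (M \<phi>0) s))"
    if "\<phi> \<in> hball m \<phi>0" for \<phi>
  proof -
    have *: "hsemi n (\<phi> - \<phi>0) < \<rho>" "hsemi N (\<phi> - \<phi>0) < \<rho>"
      using m that hsemi_mono[of n "max n N" "\<phi> - \<phi>0"] hsemi_mono[of N "max n N" "\<phi> - \<phi>0"] by fastforce+
    then have \<delta>: "hsemi n (\<phi> - \<phi>0) < \<delta>" using \<rho>(2) by simp
    moreover have "segment (M \<phi>) s \<in> hball N (segment (M \<phi>0) s)" if s: "s \<in> {0..T}" for s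
    proof -
      have "?G * hsemi n (\<phi> - \<phi>0) \<le> ?G * \<rho>" using G *(1) by (intro mult_left_mono) auto
      then have "hsemi N (segment (M \<phi>) s - segment (M \<phi>0) s) < \<rho> + ?G * \<rho>"
        using flow_box_lipschitz[OF box T \<delta> flow_box_center[OF box] s, of N] *(2) by linarith
      also have "\<dots> = (1 + ?G) * \<rho>" by (simp add: algebra_simps)
      finally show ?thesis using \<rho>_le by (simp add: hball_def)
    qed
    ultimately show ?thesis by blast
  qed
  then show ?thesis by blast
qed

lemma dir_deriv_solution_operator_near:
  assumes t: "0 \<le> t" "ereal t < esc \<phi>0" and e: "0 < e"
  shows "\<exists>m. \<forall>\<phi>\<in>hball m \<phi>0. \<forall>v\<in>hball m v0. hsemi k (D\<Sigma> t \<phi> v - D\<Sigma> t \<phi>0 v0) < e"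
proof -
  obtain n \<delta> where box: "flow_box n \<delta> t \<phi>0" using ex_flow_box[OF t] by blast
  let ?G = "growth (real (Suc n)) t"
  have G: "1 \<le> ?G" using t by (intro growth_ge_1) auto
  \<comment> \<open>Three contributions of at most \<open>e / 4\<close> each remain in the end: the
    initial difference in seminorm \<open>k\<close>, its propagation by \<open>?G\<close>, and the
    change of base point.\<close>
  define \<eta> where "\<eta> = e / (4 * ?G)"
  have \<eta>: "0 < \<eta>" "?G * \<eta> \<le> e / 4" unfolding \<eta>_def using G e by (auto simp: field_simps)
  obtain w0 where w0: "variational t \<phi>0 w0" "segment w0 0 = v0" using ex_variational[OF t] by blast
  from Df_uniform[OF continuous_on_maximal_solution[OF t order_refl] maximal_solution_segment_in[OF t]
      variational_continuous[OF w0(1) order_refl] \<eta>(1)]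
  obtain N where N: "\<forall>s\<in>{0..t}. \<forall>\<psi>\<in>hball N (segment (M \<phi>0) s).
      norm (Df \<psi> (segment w0 s) - Df (segment (M \<phi>0) s) (segment w0 s)) < \<eta>" by blast
  obtain m1 where m1: "\<And>\<phi>. \<phi> \<in> hball m1 \<phi>0 \<Longrightarrow> hsemi n (\<phi> - \<phi>0) < \<delta>"
      "\<And>\<phi> s. \<phi> \<in> hball m1 \<phi>0 \<Longrightarrow> s \<in> {0..t} \<Longrightarrow> segment (M \<phi>) s \<in> hball N (segment (M \<phi>0) s)"
    using flow_box_near[OF box t(1), of N] by blast
  define \<rho> where "\<rho> = e / (4 * ?G)"
  have \<rho>: "0 < \<rho>" "?G * \<rho> \<le> e / 4" "\<rho> \<le> e / 4" unfolding \<rho>_def using G e by (auto simp: field_simps)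
  obtain m2 where m2: "hball m2 v0 \<subseteq> {v. hsemi (max n k) (v - v0) < \<rho>}"
    using ex_hball_subset[OF \<rho>(1)] by blast
  have "hsemi k (D\<Sigma> t \<phi> v - D\<Sigma> t \<phi>0 v0) < e" if "\<phi> \<in> hball (max m1 m2) \<phi>0" "v \<in> hball (max m1 m2) v0" for \<phi> v
  proof -
    have \<phi>: "\<phi> \<in> hball m1 \<phi>0" and v: "v \<in> hball m2 v0"
      using that hball_antimono[of m1 "max m1 m2" \<phi>0] hball_antimono[of m2 "max m1 m2" v0] by auto
    have v': "hsemi n (v - v0) < \<rho>" "hsemi k (v - v0) < \<rho>"
      using m2 v hsemi_mono[of n "max n k" "v - v0"] hsemi_mono[of k "max n k" "v - v0"] by fastforce+
    have esc: "ereal t < esc \<phi>" using box m1(1)[OF \<phi>] unfolding flow_box_def by auto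
    obtain w where w: "variational t \<phi> w" "segment w 0 = v" using ex_variational[OF t(1) esc] by blast
    have "norm (Df (segment (M \<phi>) s) (segment w0 s) - Df (segment (M \<phi>0) s) (segment w0 s)) \<le> \<eta>"
      if "s \<in> {0..t}" for s using N m1(2)[OF \<phi> that] that by (auto intro: less_imp_le)
    from variational_diff_le[OF box t(1) m1(1)[OF \<phi>] w(1) w0(1) _ this, of t k]
    have "hsemi k (segment w t - segment w0 t) \<le> hsemi k (v - v0) + ?G * (hsemi n (v - v0) + \<eta>)"
      using \<eta>(1) t(1) by (simp add: w(2) w0(2))
    also have "?G * (hsemi n (v - v0) + \<eta>) \<le> ?G * (\<rho> + \<eta>)" using v' G by (intro mult_left_mono) auto
    finally have "hsemi k (segment w t - segment w0 t) < e" using v' \<rho> \<eta> e by (simp add: algebra_simps)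
    then show ?thesis
      using dir_deriv_solution_operator[OF t(1) esc w] dir_deriv_solution_operator[OF t w0] by simp
  qed
  then show ?thesis by blast
qed

lemma C1_MB_solution_operator:
  assumes t: "0 \<le> t"
  shows "C1_MB (solution_operator_domain f U t) (solution_operator f U t)"
proof -
  have "isCont (\<lambda>(\<phi>, v). D\<Sigma> t \<phi> v) p" if p: "p \<in> solution_operator_domain f U t \<times> UNIV" for p
  proof -
    obtain \<phi> v where p_eq: "p = (\<phi>, v)" by fastforce
    have esc: "ereal t < esc \<phi>" using p mem_solution_operator_domain[OF t] unfolding p_eq by auto
    have "((\<lambda>(\<phi>, v). D\<Sigma> t \<phi> v) \<longlongrightarrow> D\<Sigma> t \<phi> v) (nhds \<phi> \<times>\<^sub>F nhds v)"
      unfolding tendsto_history_iff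
    proof (intro allI tendstoI)
      fix k and e :: real assume e: "0 < e"
      show "\<forall>\<^sub>F p in nhds \<phi> \<times>\<^sub>F nhds v. dist (hsemi k ((case p of (\<phi>, v) \<Rightarrow> D\<Sigma> t \<phi> v) - D\<Sigma> t \<phi> v)) 0 < e"
        using dir_deriv_solution_operator_near[OF t esc e]
        unfolding eventually_nhds_history_pair by (simp add: hsemi_nonneg)
    qed
    then show ?thesis
      using tendsto_at_iff_tendsto_nhds[of "\<lambda>(\<phi>, v). D\<Sigma> t \<phi> v" "(\<phi>, v)"]
      unfolding p_eq by (simp add: isCont_def nhds_prod)
  qed
  then have "continuous_on (solution_operator_domain f U t \<times> UNIV) (\<lambda>(\<phi>, v). D\<Sigma> t \<phi> v)"
    by (intro continuous_at_imp_continuous_on ballI)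
  then show ?thesis
    unfolding C1_MB_def
    using open_solution_operator_domain[OF t] continuous_on_solution_operator[OF t]
      dir_differentiable_solution_operator[OF t] mem_solution_operator_domain[OF t] by auto
qed

section \<open>Uniformity over bounded sets of directions\<close>

lemma Df_uniform_bounded:
  assumes f: "C1_F U f" and x: "continuous_on {..T} x" "\<And>s. s \<in> {0..T} \<Longrightarrow> segment x s \<in> U"
    and B: "tvs_bounded B" and e: "0 < e"
  shows "\<exists>n. \<forall>s\<in>{0..T}. \<forall>\<psi>\<in>hball n (segment x s). \<forall>v\<in>B. norm (Df \<psi> v - Df (segment x s) v) < e"
proof (rule uniform_index)
  show "\<forall>\<psi>\<in>hball n (segment x s). \<forall>v\<in>B. norm (Df \<psi> v - Df (segment x s) v) < e"
    if "\<forall>\<psi>\<in>hball m (segment x s). \<forall>v\<in>B. norm (Df \<psi> v - Df (segment x s) v) < e" "m \<le> n" for s m n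
    using that hball_antimono[OF that(2), of "segment x s"] by auto
  fix s assume s: "s \<in> {0..T}"
  obtain m where m: "\<And>\<psi> v. \<psi> \<in> hball m (segment x s) \<Longrightarrow> v \<in> B \<Longrightarrow> norm (Df \<psi> v - Df (segment x s) v) < e / 2"
    using C1_F_uniform[OF f x(2)[OF s] B, of "e / 2"] e by auto
  define n where "n = 2 * m + 1"
  obtain d where d: "0 < d" "\<And>r. r \<in> {0..T} \<Longrightarrow> \<bar>r - s\<bar> < d \<Longrightarrow> segment x r \<in> hball n (segment x s)"
    using segment_near[OF x(1) s] by blast
  have "norm (Df \<psi> v - Df (segment x r) v) < e"
    if r: "r \<in> {0..T}" "\<bar>r - s\<bar> < d" and \<psi>: "\<psi> \<in> hball n (segment x r)" and v: "v \<in> B" for r \<psi> v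
  proof -
    have sub: "hball n (segment x r) \<subseteq> hball m (segment x s)"
      using d(2)[OF r] unfolding n_def by (intro hball_half_subset)
    have "norm (Df \<psi> v - Df (segment x s) v) < e / 2" using sub \<psi> v by (intro m) auto
    moreover have "norm (Df (segment x s) v - Df (segment x r) v) < e / 2"
      using m[OF _ v, of "segment x r"] sub center_in_hball by (subst norm_minus_commute) blast
    ultimately show ?thesis
      using norm_triangle_ineq[of "Df \<psi> v - Df (segment x s) v" "Df (segment x s) v - Df (segment x r) v"] by simp
  qed
  then show "\<exists>n. \<exists>d>0. \<forall>r\<in>{0..T}. \<bar>r - s\<bar> < d \<longrightarrow>
      (\<forall>\<psi>\<in>hball n (segment x r). \<forall>v\<in>B. norm (Df \<psi> v - Df (segment x r) v) < e)"
    using d(1) by blast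
qed

text \<open>As \<open>v\<close> runs through \<open>B\<close>, the solution \<open>w0\<close> varies
  too, so \<open>Df_uniform\<close> with its single curve does not suffice. The segments of all
  these solutions form one bounded set, on which \<open>C1_F\<close> makes the change of base point
  uniformly small.\<close>

lemma dir_deriv_solution_operator_near_bounded:
  assumes f: "C1_F U f" and t: "0 \<le> t" "ereal t < esc \<phi>0" and B: "tvs_bounded B" and e: "0 < e"
  shows "\<exists>m. \<forall>\<phi>\<in>hball m \<phi>0. \<forall>v\<in>B. hsemi k (D\<Sigma> t \<phi> v - D\<Sigma> t \<phi>0 v) < e"
proof -
  obtain n \<delta> where box: "flow_box n \<delta> t \<phi>0" using ex_flow_box[OF t] by blast
  let ?G = "growth (real (Suc n)) t"
  have G: "1 \<le> ?G" using t by (intro growth_ge_1) auto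
  define \<eta> where "\<eta> = e / (2 * ?G)"
  have \<eta>: "0 < \<eta>" "?G * \<eta> < e" unfolding \<eta>_def using G e by (auto simp: field_simps)
  define B' where "B' = {segment w s | w s. variational t \<phi>0 w \<and> segment w 0 \<in> B \<and> s \<in> {0..t}}"
  have "tvs_bounded B'" unfolding tvs_bounded_history_iff
  proof
    fix j
    obtain b1 b2 where b: "\<And>v. v \<in> B \<Longrightarrow> hsemi j v \<le> b1" "\<And>v. v \<in> B \<Longrightarrow> hsemi n v \<le> b2"
      using B unfolding tvs_bounded_history_iff bdd_above_def by (metis imageI)
    have "hsemi j (segment w s) \<le> b1 + ?G * b2"
      if "variational t \<phi>0 w" "segment w 0 \<in> B" "s \<in> {0..t}" for w s
    proof -
      have "hsemi j (segment w s) \<le> hsemi j (segment w 0) + ?G * hsemi n (segment w 0)"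
        \<comment> \<open>Comparison with the zero solution at the same base point: the error is
          \<open>0\<close>, and the a priori bound remains.\<close>
        using variational_diff_le[OF box t(1) flow_box_center[OF box] that(1) variational_zero[OF t], of 0 s j] that(3)
        by (simp add: segment_const_0)
      also have "\<dots> \<le> b1 + ?G * b2" using b that(2) G by (intro add_mono mult_left_mono) auto
      finally show ?thesis .
    qed
    then show "bdd_above (hsemi j ` B')" unfolding B'_def by (auto intro!: bdd_aboveI)
  qed
  then obtain N where N: "\<And>s \<psi> v. s \<in> {0..t} \<Longrightarrow> \<psi> \<in> hball N (segment (M \<phi>0) s) \<Longrightarrow> v \<in> B' \<Longrightarrow>
      norm (Df \<psi> v - Df (segment (M \<phi>0) s) v) < \<eta>"
    using Df_uniform_bounded[OF f continuous_on_maximal_solution[OF t] maximal_solution_segment_in[OF t] _ \<eta>(1)]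
    by (metis order_refl)
  obtain m where m: "\<And>\<phi>. \<phi> \<in> hball m \<phi>0 \<Longrightarrow> hsemi n (\<phi> - \<phi>0) < \<delta>"
      "\<And>\<phi> s. \<phi> \<in> hball m \<phi>0 \<Longrightarrow> s \<in> {0..t} \<Longrightarrow> segment (M \<phi>) s \<in> hball N (segment (M \<phi>0) s)"
    using flow_box_near[OF box t(1), of N] by blast
  have "hsemi k (D\<Sigma> t \<phi> v - D\<Sigma> t \<phi>0 v) < e" if \<phi>: "\<phi> \<in> hball m \<phi>0" and v: "v \<in> B" for \<phi> v
  proof -
    have esc: "ereal t < esc \<phi>" using box m(1)[OF \<phi>] unfolding flow_box_def by auto
    obtain w where w: "variational t \<phi> w" "segment w 0 = v" using ex_variational[OF t(1) esc] by blast
    obtain w0 where w0: "variational t \<phi>0 w0" "segment w0 0 = v" using ex_variational[OF t] by blast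
    have "norm (Df (segment (M \<phi>) s) (segment w0 s) - Df (segment (M \<phi>0) s) (segment w0 s)) \<le> \<eta>"
      if s: "s \<in> {0..t}" for s
      using w0 v s by (intro less_imp_le N m(2)[OF \<phi>]) (auto simp: B'_def)
    \<comment> \<open>Both solutions start at \<open>v\<close>, so only the change of base point
      contributes.\<close>
    from variational_diff_le[OF box t(1) m(1)[OF \<phi>] w(1) w0(1) _ this, of t k]
    have "hsemi k (segment w t - segment w0 t) \<le> ?G * \<eta>"
      using \<eta>(1) t(1) by (simp add: w(2) w0(2) hsemi_zero)
    then show ?thesis
      using \<eta>(2) dir_deriv_solution_operator[OF t(1) esc w] dir_deriv_solution_operator[OF t w0] by simp
  qed
  then show ?thesis by blast
qed

text \<open>Each derivative lies in \<open>Lc\<close> by linearity and by the joint continuity of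
  the \<open>C1_MB\<close> case with the base point fixed; what \<open>C1_F\<close> adds is the
  uniform estimate over bounded sets.\<close>

lemma C1_F_solution_operator:
  assumes f: "C1_F U f" and t: "0 \<le> t"
  shows "C1_F (solution_operator_domain f U t) (solution_operator f U t)"
proof -
  let ?O = "solution_operator_domain f U t"
  have MB: "C1_MB ?O (solution_operator f U t)" by (rule C1_MB_solution_operator[OF t])
  have Lc: "D\<Sigma> t \<phi> \<in> Lc" if \<phi>: "\<phi> \<in> ?O" for \<phi>
  proof -
    have "continuous_on (?O \<times> UNIV) (\<lambda>(\<phi>, v). D\<Sigma> t \<phi> v)"
      using MB unfolding C1_MB_def by blast
    moreover have "continuous_on UNIV (Pair \<phi>)"
      by (intro continuous_on_Pair continuous_on_const continuous_on_id)
    ultimately have "continuous_on UNIV (\<lambda>v. case (\<phi>, v) of (\<phi>, v) \<Rightarrow> D\<Sigma> t \<phi> v)"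
      by (rule continuous_on_compose2) (use \<phi> in auto)
    then have "continuous_on UNIV (D\<Sigma> t \<phi>)" by simp
    then show ?thesis
      using linear_dir_deriv_solution_operator[OF t] \<phi> mem_solution_operator_domain[OF t]
      unfolding Lc_def by auto
  qed
  have "continuous_map (top_of_set ?O) Lc_topology (\<lambda>\<phi>. D\<Sigma> t \<phi>)"
  proof (rule continuous_map_into_Lc_topologyI[OF Lc])
    fix \<phi> :: "'b history" and B :: "'b history set" and N :: "'b history set"
    assume \<phi>: "\<phi> \<in> ?O" and B: "tvs_bounded B" and N: "open N" "0 \<in> N"
    obtain k e where "0 < e" and N': "\<And>\<psi>. hsemi k (\<psi> - 0) < e \<Longrightarrow> \<psi> \<in> N"
      using N unfolding open_history_def by blast
    have "ereal t < esc \<phi>" using \<phi> mem_solution_operator_domain[OF t] by blast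
    from dir_deriv_solution_operator_near_bounded[OF f t this B \<open>0 < e\<close>]
    obtain n where n: "\<forall>\<psi>\<in>hball n \<phi>. \<forall>v\<in>B. hsemi k (D\<Sigma> t \<psi> v - D\<Sigma> t \<phi> v) < e" by blast
    show "\<exists>n. \<forall>\<psi>\<in>hball n \<phi> \<inter> ?O. \<forall>v\<in>B. D\<Sigma> t \<psi> v - D\<Sigma> t \<phi> v \<in> N"
      using n by (intro exI[of _ n]) (auto intro!: N')
  qed
  with MB Lc show ?thesis unfolding C1_MB_def C1_F_def by auto
qed

end

theorem corollary4p3:
  fixes star :: smoothness
    and U :: "(real ^ 'n) history set"
    and f :: "(real ^ 'n) history \<Rightarrow> real ^ 'n"
  assumes "open U"
    and "C1_smooth star U f"
  shows "semiflow f U \<in> semiflow_domain f U \<rightarrow> U \<and>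
    continuous_on (semiflow_domain f U) (semiflow f U) \<and>
    (\<forall>t\<ge>0. openin (top_of_set U) (solution_operator_domain f U t)) \<and>
    (\<forall>t\<ge>0. solution_operator_domain f U t \<noteq> {} \<longrightarrow>
      C1_smooth star (solution_operator_domain f U t) (solution_operator f U t))"
proof -
  have "C1_MB U f" using assms(2) C1_F_imp_C1_MB by (cases star) auto
  then interpret mb_smooth f U by unfold_locales
  have "openin (top_of_set U) (solution_operator_domain f U t)" if "0 \<le> t" for t
    using open_solution_operator_domain[OF that]
    by (intro open_subset) (auto simp: solution_operator_domain_def)
  moreover have "C1_smooth star (solution_operator_domain f U t) (solution_operator f U t)" if "0 \<le> t" for t
    using assms(2) C1_MB_solution_operator[OF that] C1_F_solution_operator[OF _ that] by (cases star) auto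
  ultimately show ?thesis using semiflow_in continuous_on_semiflow by blast
qed

end
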